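(* Let $A\in\mathbb{R}^{3\times 3}$ be a symmetric positive definite matrix and let $\overline P(x)=\frac12 x\cdot Ax$ be the associated steady solution of the semi-geostrophic equations on $\mathbb{R}^3$. If $\mu_A<0$ (elliptic flow), then $\overline P$ is stable to plane-wave perturbations. If $\mu_A>0$ (hyperbolic flow), then $\overline P$ is unstable to plane-wave perturbations.
   Context: Write $A=\begin{pmatrix} a & b & c \\ b & d & e \\ c & e & f \end{pmatrix}$ and $$\mu_A=af-c^2+df-e^2-f-\det A .$$ Let $I$ be the $3\times3$ identity matrix, $J=\begin{pmatrix} 0 & -1 & 0 \\ 1 & 0 & 0 \\ 0 & 0 & 0 \end{pmatrix}$, $S=A^{-1}J(A-I)$, $\overline u(x)=Sx$ (the steady velocity), and $m(x)=2\,\frac{x\cdot A^{-1}Jx}{x\cdot A^{-1}x}$ for $x\in\mathbb{R}^3\setminus\{0\}$; $\mathscr M_m$ is multiplication by $m$. With $\mathscr F[\phi](\xi)=\int_{\mathbb{R}^3}\phi(x)e^{-2\pi i\xi\cdot x}dx$ and its inverse $\mathscr F^{-1}$, the linearised semi-geostrophic equation (LSG) associated with $\overline P$ is $\frac{d}{dt}\phi=\mathscr L\phi$, where $$\mathscr L\phi=-(\overline u\cdot\nabla)\phi-S^T\phi+\mathscr F^{-1}\circ\mathscr M_m\circ\mathscr F[\phi].$$ A plane-wave solution of LSG is a function of the form $$\phi(x,t)=\nabla f(x,t),\qquad f(x,t)=a(t)e^{2\pi i k(t)\cdot x},$$ with functions $a:\mathbb{R}\to\mathbb{R}$ and $k:\mathbb{R}\to\mathbb{R}^3$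 (not to be confused with the entry $a$ of $A$), such that the regular distribution $\eta_{\phi(\cdot,t)}$, $\langle\eta_{\phi(\cdot,t)},\psi\rangle=\int_{\mathbb{R}^3}\phi(x,t)\cdot\psi(x)\,dx$, is a strong solution of LSG in $\mathcal S'(\mathbb{R}^3,\mathbb{R}^3)$: $t\mapsto\eta_{\phi(\cdot,t)}$ is $\mathcal C^1$ from $\mathbb{R}$ into $\mathcal S'$ with the weak*-topology, and $\frac{d}{dt}\eta_{\phi(\cdot,t)}=\mathscr L\eta_{\phi(\cdot,t)}$ in $\mathcal S'$ for all $t\in\mathbb{R}$. Here $\mathscr L\eta_\phi=\eta_{\mathscr L\phi}$, and the Fourier multiplier acts on plane waves by $\mathscr F^{-1}\circ\mathscr M_m\circ\mathscr F[v\,e^{2\pi i k\cdot x}]=m(k)\,v\,e^{2\pi i k\cdot x}$ for constant vectors $v$ and $k\in\mathbb{R}^3\setminus\{0\}$. $\overline P$ is stable to plane-wave perturbations if every plane-wave solution $\phi$ of the associated LSG is in $L^\infty(\mathbb{R}^3\times\mathbb{R})$. Otherwise it is unstable to plane-wave perturbations, i.e. there exists a plane-wave solution $\phi$ of LSG such that $\|\phi(\cdot,t)\|_{L^\infty(\mathbb{R}^3)}$ is unbounded as a function of $t\in\mathbb{R}$. *)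

theory Defs
  imports "HOL-Analysis.Analysis" "HOL-Probability.Essential_Supremum"
begin

section \<open>Quadratic steady states\<close>

definition potential :: "real^3^3 \<Rightarrow> real^3 \<Rightarrow> real" where
  "potential A x = (1/2) * (x \<bullet> (A *v x))"

text \<open>
  The equation linearised at a quadratic potential is written in terms of its symmetric matrix, which
  the potential determines.
\<close>

definition potential_matrix :: "(real^3 \<Rightarrow> real) \<Rightarrow> real^3^3" where
  "potential_matrix P = (THE A. transpose A = A \<and> P = potential A)"

lemma potential_inject:
  assumes sym: "transpose A = A" "transpose B = B" and eq: "potential A = potential B"
  shows "A = B"
proof -
  have sa: "x \<bullet> (A *v y) = y \<bullet> (A *v x)" for x y
    using sym(1) by (metis dot_lmul_matrix inner_commute transpose_matrix_vector)
  have sb: "x \<bullet> (B *v y) = y \<bullet> (B *v x)" for x y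
    using sym(2) by (metis dot_lmul_matrix inner_commute transpose_matrix_vector)
  have q: "x \<bullet> (A *v x) = x \<bullet> (B *v x)" for x
    using fun_cong[OF eq, of x] by (simp add: potential_def)
  have "x \<bullet> (A *v y) = x \<bullet> (B *v y)" for x y
    using q[of "x + y"] q[of x] q[of y] sa[of x y] sb[of x y]
    by (simp add: matrix_vector_right_distrib inner_add_left inner_add_right)
  then have "A *v y = B *v y" for y
    by (metis vector_eq_ldot)
  then show ?thesis by (simp add: matrix_eq)
qed

lemma potential_matrix_potential: "transpose A = A \<Longrightarrow> potential_matrix (potential A) = A"
  unfolding potential_matrix_def by (rule the_equality) (auto intro: potential_inject)

definition positive_definite :: "real^3^3 \<Rightarrow> bool" where
  "positive_definite A \<longleftrightarrow> (\<forall>x. x \<noteq> 0 \<longrightarrow> 0 < x \<bullet> (A *v x))"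

definition mu :: "real^3^3 \<Rightarrow> real" where
  "mu A = (let a = A $ 1 $ 1; c = A $ 1 $ 3; d = A $ 2 $ 2; e = A $ 2 $ 3; f = A $ 3 $ 3
           in a * f - c\<^sup>2 + d * f - e\<^sup>2 - f - det A)"

definition J :: "real^3^3" where
  "J = vector [vector [0, -1, 0], vector [1, 0, 0], vector [0, 0, 0]]"

definition velocity_matrix :: "real^3^3 \<Rightarrow> real^3^3" where
  "velocity_matrix A = matrix_inv A ** J ** (A - mat 1)"

definition steady_velocity :: "real^3^3 \<Rightarrow> real^3 \<Rightarrow> real^3" where
  "steady_velocity A x = velocity_matrix A *v x"

definition symbol_m :: "real^3^3 \<Rightarrow> real^3 \<Rightarrow> real" where
  "symbol_m A x = 2 * ((x \<bullet> ((matrix_inv A ** J) *v x)) / (x \<bullet> (matrix_inv A *v x)))"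


section \<open>The Fourier multiplier\<close>

type_synonym cfield = "real^3 \<Rightarrow> complex^3"

definition fourier :: "cfield \<Rightarrow> cfield" where
  "fourier \<phi> \<xi> = (LINT x|lborel. exp (- 2 * of_real pi * \<i> * of_real (\<xi> \<bullet> x)) *s \<phi> x)"

definition inverse_fourier :: "cfield \<Rightarrow> cfield" where
  "inverse_fourier \<phi> x = (LINT \<xi>|lborel. exp (2 * of_real pi * \<i> * of_real (\<xi> \<bullet> x)) *s \<phi> \<xi>)"

definition plane_wave :: "real^3 \<Rightarrow> complex^3 \<Rightarrow> cfield" where
  "plane_wave k v x = exp (2 * of_real pi * \<i> * of_real (k \<bullet> x)) *s v"

text \<open>
  On a plane wave \<open>v exp (2\<pi>ik\<cdot>x)\<close> with \<open>k \<noteq> 0\<close>, which is not integrable unless \<open>v = 0\<close>, the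
  multiplier is understood in the tempered sense: the transform is \<open>v\<close> times the point mass at
  \<open>k\<close>, and the symbol, continuous near \<open>k\<close>, scales it by \<open>m k\<close>.  The definite description is
  unambiguous; see the lemma below.
\<close>

definition fourier_multiplier :: "(real^3 \<Rightarrow> real) \<Rightarrow> cfield \<Rightarrow> cfield" where
  "fourier_multiplier m \<phi> =
     (if \<exists>k v. k \<noteq> 0 \<and> \<phi> = plane_wave k v
      then THE \<omega>. \<exists>k v. k \<noteq> 0 \<and> \<phi> = plane_wave k v \<and> \<omega> = plane_wave k (of_real (m k) *s v)
      else inverse_fourier (\<lambda>\<xi>. of_real (m \<xi>) *s fourier \<phi> \<xi>))"

lemma plane_wave_eqD:
  assumes eq: "plane_wave k v = plane_wave k' v'" 
  shows "v = v' \<and> (v = 0 \<or> k = k')"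
proof -
  have pw: "exp (2 * of_real pi * \<i> * of_real (k \<bullet> x)) *s v
          = exp (2 * of_real pi * \<i> * of_real (k' \<bullet> x)) *s v'" for x
    using fun_cong[OF eq, of x] by (simp add: plane_wave_def)
  have v: "v = v'" using pw[of 0] by simp
  have "k = k'" if nz: "v \<noteq> 0"
  proof (rule ccontr)
    assume "k \<noteq> k'"
    define w where "w = k - k'"
    have w: "w \<noteq> 0" using \<open>k \<noteq> k'\<close> by (simp add: w_def)
    define x where "x = (1 / (2 * (w \<bullet> w))) *\<^sub>R w"
    have wx: "k \<bullet> x = k' \<bullet> x + 1/2"
    proof -
      have "w \<bullet> x = 1/2" using w by (simp add: x_def)
      then show ?thesis by (simp add: w_def inner_diff_left)
    qed
    obtain i where i: "v $ i \<noteq> 0" using nz by (metis vec_eq_iff zero_index)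
    have "exp (2 * of_real pi * \<i> * of_real (k \<bullet> x)) * v $ i
        = exp (2 * of_real pi * \<i> * of_real (k' \<bullet> x)) * v $ i"
      using pw[of x] v by (metis vector_smult_component)
    then have "exp (2 * of_real pi * \<i> * of_real (k \<bullet> x))
        = exp (2 * of_real pi * \<i> * of_real (k' \<bullet> x))" using i by simp
    moreover have "exp (2 * of_real pi * \<i> * of_real (k \<bullet> x))
        = - exp (2 * of_real pi * \<i> * of_real (k' \<bullet> x))"
    proof -
      have "2 * of_real pi * \<i> * of_real (k \<bullet> x)
          = 2 * of_real pi * \<i> * of_real (k' \<bullet> x) + of_real pi * \<i>"
        by (simp add: wx algebra_simps)
      then show ?thesis by (simp add: exp_add)
    qed
    ultimately show False by simp
  qed
  then show ?thesis using v by blast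
qed

lemma fourier_multiplier_plane_wave:
  assumes k: "k \<noteq> 0"
  shows "fourier_multiplier m (plane_wave k v) = plane_wave k (of_real (m k) *s v)"
proof -
  have ex: "\<exists>k' v'. k' \<noteq> 0 \<and> plane_wave k v = plane_wave k' v'" using k by blast
  have "(THE \<omega>. \<exists>k' v'. k' \<noteq> 0 \<and> plane_wave k v = plane_wave k' v' \<and>
                  \<omega> = plane_wave k' (of_real (m k') *s v')) = plane_wave k (of_real (m k) *s v)"
  proof (rule the_equality)
    show "\<exists>k' v'. k' \<noteq> 0 \<and> plane_wave k v = plane_wave k' v' \<and>
            plane_wave k (of_real (m k) *s v) = plane_wave k' (of_real (m k') *s v')"
      using k by blast
  next
    fix \<omega>
    assume "\<exists>k' v'. k' \<noteq> 0 \<and> plane_wave k v = plane_wave k' v' \<and>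
              \<omega> = plane_wave k' (of_real (m k') *s v')"
    then obtain k' v' where *: "plane_wave k v = plane_wave k' v'"
      "\<omega> = plane_wave k' (of_real (m k') *s v')" by blast
    show "\<omega> = plane_wave k (of_real (m k) *s v)"
      using plane_wave_eqD[OF *(1)] *(2) by (auto simp: plane_wave_def fun_eq_iff)
  qed
  then show ?thesis using ex by (simp add: fourier_multiplier_def)
qed


section \<open>The operator of the linearised equation\<close>

text \<open>
  \<open>frechet_derivative \<phi> (at x) (steady_velocity A x)\<close> is \<open>(u \<cdot> \<nabla>) \<phi>\<close> at \<open>x\<close>, the derivative of
  \<open>\<phi>\<close> along the steady velocity.
\<close>

definition lsg_operator :: "real^3^3 \<Rightarrow> cfield \<Rightarrow> cfield" where
  "lsg_operator A \<phi> x =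
     - frechet_derivative \<phi> (at x) (steady_velocity A x)
     - map_matrix of_real (transpose (velocity_matrix A)) *v \<phi> x
     + fourier_multiplier (symbol_m A) \<phi> x"


section \<open>Tempered distributions\<close>

fun partial_derivs :: "3 list \<Rightarrow> (real^3 \<Rightarrow> real^3) \<Rightarrow> real^3 \<Rightarrow> real^3" where
  "partial_derivs [] \<psi> = \<psi>"
| "partial_derivs (j # js) \<psi> = (\<lambda>x. frechet_derivative (partial_derivs js \<psi>) (at x) (axis j 1))"

definition schwartz :: "(real^3 \<Rightarrow> real^3) set" where
  "schwartz = {\<psi>. \<forall>js. (\<forall>x. partial_derivs js \<psi> differentiable (at x)) \<and>
                  (\<forall>N. bounded (range (\<lambda>x. (1 + norm x) ^ N *\<^sub>R partial_derivs js \<psi> x)))}"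

definition schwartz_seminorm :: "nat \<Rightarrow> (real^3 \<Rightarrow> real^3) \<Rightarrow> real" where
  "schwartz_seminorm N \<psi> =
     (\<Sum>js | length js \<le> N. SUP x. (1 + norm x) ^ N * norm (partial_derivs js \<psi> x))"

text \<open>
  Plane waves are complex valued while test functions are real, so distributions are the continuous
  real-linear functionals on the Schwartz space with values in the complex numbers (equivalently,
  the complexification of the real-valued ones).  They are extensional, i.e. \<open>undefined\<close> outside
  the Schwartz space, so that equality of distributions is equality of functions and the weak*
  topology is a subspace of a product topology.
\<close>

definition tempered :: "((real^3 \<Rightarrow> real^3) \<Rightarrow> complex) set" where
  "tempered = {T \<in> extensional schwartz.
     (\<forall>\<psi>\<in>schwartz. \<forall>\<psi>'\<in>schwartz. T (\<lambda>x. \<psi> x + \<psi>' x) = T \<psi> + T \<psi>') \<and>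
     (\<forall>c. \<forall>\<psi>\<in>schwartz. T (\<lambda>x. c *\<^sub>R \<psi> x) = of_real c * T \<psi>) \<and>
     (\<exists>C N. \<forall>\<psi>\<in>schwartz. norm (T \<psi>) \<le> C * schwartz_seminorm N \<psi>)}"

definition weak_star :: "((real^3 \<Rightarrow> real^3) \<Rightarrow> complex) topology" where
  "weak_star = subtopology (product_topology (\<lambda>_. euclidean) schwartz) tempered"

text \<open>The pairing is bilinear: there is no complex conjugation.\<close>

definition regular_distribution :: "cfield \<Rightarrow> (real^3 \<Rightarrow> real^3) \<Rightarrow> complex" where
  "regular_distribution \<phi> =
     (\<lambda>\<psi>\<in>schwartz. LINT x|lborel. (\<Sum>j\<in>UNIV. \<phi> x $ j * of_real (\<psi> x $ j)))"

definition C1_weak_star ::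
  "(real \<Rightarrow> (real^3 \<Rightarrow> real^3) \<Rightarrow> complex) \<Rightarrow> (real \<Rightarrow> (real^3 \<Rightarrow> real^3) \<Rightarrow> complex) \<Rightarrow> bool" where
  "C1_weak_star \<eta> \<eta>' \<longleftrightarrow>
     continuous_map euclideanreal weak_star \<eta> \<and>
     (\<forall>t. limitin weak_star (\<lambda>h. \<lambda>\<psi>\<in>schwartz. (\<eta> (t + h) \<psi> - \<eta> t \<psi>) / of_real h) (\<eta>' t) (at 0)) \<and>
     continuous_map euclideanreal weak_star \<eta>'"


section \<open>Plane-wave solutions and stability\<close>

definition strong_solution :: "real^3^3 \<Rightarrow> (real^3 \<Rightarrow> real \<Rightarrow> complex^3) \<Rightarrow> bool" where
  "strong_solution A \<phi> \<longleftrightarrow>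
     (\<exists>\<eta>'. C1_weak_star (\<lambda>t. regular_distribution (\<lambda>x. \<phi> x t)) \<eta>' \<and>
           (\<forall>t. \<eta>' t = regular_distribution (lsg_operator A (\<lambda>x. \<phi> x t))))"

definition gradient :: "(real^3 \<Rightarrow> complex) \<Rightarrow> cfield" where
  "gradient f x = (\<chi> j. frechet_derivative f (at x) (axis j 1))"

definition plane_wave_solution :: "real^3^3 \<Rightarrow> (real^3 \<Rightarrow> real \<Rightarrow> complex^3) \<Rightarrow> bool" where
  "plane_wave_solution A \<phi> \<longleftrightarrow>
     (\<exists>(a :: real \<Rightarrow> real) (k :: real \<Rightarrow> real^3).
        \<phi> = (\<lambda>x t. gradient (\<lambda>y. of_real (a t) * exp (2 * of_real pi * \<i> * of_real (k t \<bullet> y))) x)) \<and>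
     strong_solution A \<phi>"

definition L_infty_norm :: "('a::euclidean_space \<Rightarrow> complex^3) \<Rightarrow> ereal" where
  "L_infty_norm g = esssup lebesgue (\<lambda>z. ereal (norm (g z)))"

definition L_infty :: "('a::euclidean_space \<Rightarrow> complex^3) set" where
  "L_infty = {g \<in> borel_measurable lebesgue. L_infty_norm g < \<infinity>}"

definition plane_wave_stable :: "(real^3 \<Rightarrow> real) \<Rightarrow> bool" where
  "plane_wave_stable P \<longleftrightarrow>
     (\<forall>\<phi>. plane_wave_solution (potential_matrix P) \<phi> \<longrightarrow> (\<lambda>(x, t). \<phi> x t) \<in> L_infty)"

definition plane_wave_unstable :: "(real^3 \<Rightarrow> real) \<Rightarrow> bool" where
  "plane_wave_unstable P \<longleftrightarrow> \<not> plane_wave_stable P"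

definition has_unbounded_plane_wave :: "(real^3 \<Rightarrow> real) \<Rightarrow> bool" where
  "has_unbounded_plane_wave P \<longleftrightarrow>
     (\<exists>\<phi>. plane_wave_solution (potential_matrix P) \<phi> \<and>
          (\<forall>C::real. \<exists>t. L_infty_norm (\<lambda>x. \<phi> x t) > ereal C))"

end

theory Submission
  imports Defs "HOL-Probability.Characteristic_Functions" "HOL-Probability.Sinc_Integral"
    "HOL-Real_Asymp.Real_Asymp"
begin

text \<open>
  On plane waves the linearised equation is a system of ordinary differential equations.  Write
  \<open>\<phi> = \<nabla> (a exp (2\<pi>ik\<cdot>x))\<close>.  As long as \<open>\<phi>\<close> does not vanish, \<open>\<phi>\<close> solves the equation iff
  \<open>k' = - S\<^sup>T k\<close> and \<open>a' = m k * a\<close>.  With \<open>y = A\<^sup>-\<^sup>1 k\<close> and \<open>B = I - A\<^sup>-\<^sup>1\<close> the first equation becomes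
  \<open>y' = B J y\<close>, and the definition of \<open>m\<close> says exactly that \<open>a (k \<cdot> A\<^sup>-\<^sup>1 k)\<close> is constant
  (\<open>amplitude_integral_conserved\<close>).  So the size of \<open>\<phi>\<close>, which is \<open>2\<pi>\<bar>a\<bar>\<bar>k\<bar>\<close>, is comparable to \<open>1 / \<bar>k\<bar>\<close>:
  a wave can grow only if \<open>k\<close> tends to zero.

  The matrix \<open>B J\<close> has eigenvalues \<open>0\<close> and the two square roots of \<open>-q\<close>, where \<open>q\<close> is the upper left
  \<open>2 \<times> 2\<close> minor of \<open>B\<close>, and \<open>q * det A = - mu A\<close> (\<open>q_det\<close>).  If \<open>mu A > 0\<close>, an eigenvector for
  the eigenvalue \<open>- sqrt (- q)\<close> gives a wave vector that decays exponentially, hence an unbounded solution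
  (\<open>unbounded_wave\<close>).  If \<open>mu A < 0\<close>, the system \<open>y' = B J y\<close> conserves a positive definite
  quadratic form (\<open>integral_matrix_conserved\<close>), so \<open>y\<close> stays on a compact set that misses the
  origin, and \<open>\<phi>\<close> is bounded.

  For stability every weak solution matters, and there \<open>a\<close> and \<open>k\<close> are arbitrary functions, determined
  by \<open>\<phi>\<close> only where \<open>\<phi>\<close> does not vanish.  Testing against Gaussians and against coordinates times
  Gaussians gives the moments \<open>a k\<^sub>j G\<close> and \<open>a k\<^sub>j k\<^sub>l G\<close>, with \<open>G\<close> the transform of the Gaussian at \<open>k\<close>.
  They are differentiable in time, their quotients recover \<open>k\<close>, and so the ordinary differential equations hold on
  the open set of times at which \<open>\<phi> \<noteq> 0\<close> (\<open>wave_vector_ode\<close>, \<open>amplitude_ode\<close>).  On a connected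
  component of this set the conserved quantities bound the moments away from zero; the component is therefore closed,
  and a solution that is not identically zero never vanishes (\<open>support_empty_or_UNIV\<close>).
\<close>

section \<open>Fourier integrals of functions with finite moments\<close>

text \<open>
  The oscillation \<open>exp (2\<pi>ik\<cdot>x)\<close>.  As a defined constant it protects the exponent from the simplifier.
\<close>

definition osc :: "'a::euclidean_space \<Rightarrow> 'a \<Rightarrow> complex" where
  "osc k x = exp (2 * of_real pi * \<i> * of_real (k \<bullet> x))"

lemma norm_osc [simp]: "norm (osc k x) = 1"
  by (simp add: osc_def norm_exp_eq_Re)

lemma osc_add: "osc (k + h) x = osc k x * osc h x"
  by (simp add: osc_def exp_add [symmetric] algebra_simps inner_add_left)

lemma continuous_osc [continuous_intros]:
  assumes "continuous_on S f" "continuous_on S g"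
  shows "continuous_on S (\<lambda>s. osc (f s) (g s))"
  unfolding osc_def by (intro continuous_intros assms)

lemma borel_measurable_osc [measurable]: "osc k \<in> borel_measurable borel"
  by (intro borel_measurable_continuous_onI continuous_intros)

lemma osc_first_order:
  "norm (osc (k + h) x - osc k x - 2 * of_real pi * \<i> * of_real (h \<bullet> x) * osc k x)
     \<le> 2 * pi\<^sup>2 * (norm h)\<^sup>2 * (norm x)\<^sup>2"
proof -
  have "osc (k + h) x - osc k x - 2 * of_real pi * \<i> * of_real (h \<bullet> x) * osc k x
      = osc k x * (osc h x - 1 - 2 * of_real pi * \<i> * of_real (h \<bullet> x))"
    by (simp add: osc_add algebra_simps)
  then have "norm (osc (k + h) x - osc k x - 2 * of_real pi * \<i> * of_real (h \<bullet> x) * osc k x)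
      = norm (osc h x - 1 - 2 * of_real pi * \<i> * of_real (h \<bullet> x))"
    by (simp add: norm_mult)
  also have "\<dots> \<le> \<bar>2 * pi * (h \<bullet> x)\<bar>\<^sup>2 / 2"
    using iexp_approx1[of "2 * pi * (h \<bullet> x)" 1]
    by (simp add: osc_def numeral_2_eq_2 [symmetric] algebra_simps)
  also have "\<dots> = 2 * pi\<^sup>2 * \<bar>h \<bullet> x\<bar>\<^sup>2"
    by (simp add: power_mult_distrib)
  also have "\<dots> \<le> 2 * pi\<^sup>2 * (norm h * norm x)\<^sup>2"
    by (intro mult_left_mono power_mono Cauchy_Schwarz_ineq2) auto
  finally show ?thesis
    by (simp add: power_mult_distrib mult.assoc)
qed

text \<open>
  All absolute moments are finite.  This is what differentiation under the Fourier integral needs, and it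
  is inherited by products with linear functions, so that the derivative may be differentiated again.
\<close>

definition all_moments :: "('a::euclidean_space \<Rightarrow> real) \<Rightarrow> bool" where
  "all_moments p \<longleftrightarrow> (\<forall>N. integrable lborel (\<lambda>x. (1 + norm x) ^ N * p x))"

lemma all_moments_integrable:
  assumes "all_moments p" shows "integrable lborel p"
  using assms[unfolded all_moments_def, rule_format, of 0] by simp

lemma all_moments_measurable:
  assumes "all_moments p" shows "p \<in> borel_measurable borel"
  using all_moments_integrable[OF assms] by auto

lemma integrable_all_moments_bound:
  fixes f :: "'a::euclidean_space \<Rightarrow> 'b::{banach, second_countable_topology}"
  assumes p: "all_moments p" and f: "f \<in> borel_measurable borel"
    and le: "\<And>x. norm (f x) \<le> C * (1 + norm x) ^ N * \<bar>p x\<bar>"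
  shows "integrable lborel f"
proof (rule Bochner_Integration.integrable_bound)
  show "integrable lborel (\<lambda>x. C * ((1 + norm x) ^ N * p x))"
    using p by (auto simp: all_moments_def)
  show "f \<in> borel_measurable lborel" using f by simp
  have "C * (1 + norm x) ^ N * \<bar>p x\<bar> \<le> \<bar>C * ((1 + norm x) ^ N * p x)\<bar>" for x
    by (simp add: abs_mult mult.assoc mult_right_mono)
  then show "AE x in lborel. norm (f x) \<le> norm (C * ((1 + norm x) ^ N * p x))"
    using le by (intro AE_I2) (metis order_trans real_norm_def)
qed

lemma all_moments_inner_mult:
  assumes p: "all_moments p" shows "all_moments (\<lambda>x. (h \<bullet> x) * p x)"
  unfolding all_moments_def
proof
  fix N
  have [measurable]: "p \<in> borel_measurable borel" by (rule all_moments_measurable[OF p])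
  show "integrable lborel (\<lambda>x. (1 + norm x) ^ N * ((h \<bullet> x) * p x))"
  proof (rule integrable_all_moments_bound[OF p, where N = "Suc N" and C = "norm h"])
    fix x
    have "\<bar>h \<bullet> x\<bar> \<le> norm h * (1 + norm x)"
      by (rule order_trans[OF Cauchy_Schwarz_ineq2]) (simp add: algebra_simps)
    then have "(1 + norm x) ^ N * \<bar>p x\<bar> * \<bar>h \<bullet> x\<bar> \<le> (1 + norm x) ^ N * \<bar>p x\<bar> * (norm h * (1 + norm x))"
      by (intro mult_left_mono) auto
    then show "norm ((1 + norm x) ^ N * ((h \<bullet> x) * p x)) \<le> norm h * (1 + norm x) ^ Suc N * \<bar>p x\<bar>"
      by (simp add: abs_mult mult_ac)
  qed simp
qed

text \<open>
  The inverse Fourier transform of \<open>p\<close> at \<open>k\<close>, that is, the pairing of \<open>p\<close> with the plane wave of wave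
  vector \<open>k\<close>.
\<close>

definition osc_integral :: "('a::euclidean_space \<Rightarrow> real) \<Rightarrow> 'a \<Rightarrow> complex" where
  "osc_integral p k = (LINT x|lborel. osc k x * of_real (p x))"

lemma integrable_osc:
  assumes p: "all_moments p" shows "integrable lborel (\<lambda>x. osc k x * of_real (p x))"
proof -
  have [measurable]: "p \<in> borel_measurable borel" by (rule all_moments_measurable[OF p])
  show ?thesis
    by (rule integrable_all_moments_bound[OF p, where N = 0 and C = 1]) (simp_all add: norm_mult)
qed

lemma osc_integral_linear:
  assumes p: "all_moments p"
  shows "bounded_linear (\<lambda>h. osc_integral (\<lambda>x. (h \<bullet> x) * p x) k)"
proof (rule bounded_linear_intro[where K = "LINT x|lborel. norm x * \<bar>p x\<bar>"])
  have [measurable]: "p \<in> borel_measurable borel" by (rule all_moments_measurable[OF p])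
  have int: "integrable lborel (\<lambda>x. osc k x * of_real ((h \<bullet> x) * p x))" for h
    by (rule integrable_osc[OF all_moments_inner_mult[OF p]])
  fix h h' :: 'a and r :: real
  show "osc_integral (\<lambda>x. ((h + h') \<bullet> x) * p x) k
      = osc_integral (\<lambda>x. (h \<bullet> x) * p x) k + osc_integral (\<lambda>x. (h' \<bullet> x) * p x) k"
    unfolding osc_integral_def
    by (subst Bochner_Integration.integral_add [OF int int, symmetric])
       (simp add: inner_add_left algebra_simps)
  show "osc_integral (\<lambda>x. ((r *\<^sub>R h) \<bullet> x) * p x) k = r *\<^sub>R osc_integral (\<lambda>x. (h \<bullet> x) * p x) k"
    unfolding osc_integral_def
    by (subst integral_scaleR_right [symmetric]) (simp_all add: scaleR_conv_of_real mult_ac)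
  have "norm (osc_integral (\<lambda>x. (h \<bullet> x) * p x) k) \<le> (LINT x|lborel. norm h * (norm x * \<bar>p x\<bar>))"
    unfolding osc_integral_def
  proof (rule Bochner_Integration.integral_norm_bound_integral[OF int])
    show "integrable lborel (\<lambda>x. norm h * (norm x * \<bar>p x\<bar>))"
    proof (rule integrable_all_moments_bound[OF p, where N = 1 and C = "norm h"])
      show "norm (norm h * (norm x * \<bar>p x\<bar>)) \<le> norm h * (1 + norm x) ^ 1 * \<bar>p x\<bar>" for x
        by (simp add: mult_left_mono mult_right_mono mult.assoc)
    qed simp
    fix x
    show "norm (osc k x * of_real ((h \<bullet> x) * p x)) \<le> norm h * (norm x * \<bar>p x\<bar>)"
      using mult_right_mono[OF Cauchy_Schwarz_ineq2[of h x], of "\<bar>p x\<bar>"]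
      by (simp add: norm_mult mult.assoc abs_mult)
  qed
  then show "norm (osc_integral (\<lambda>x. (h \<bullet> x) * p x) k) \<le> norm h * (LINT x|lborel. norm x * \<bar>p x\<bar>)"
    by simp
qed

lemma osc_integral_has_derivative:
  assumes p: "all_moments p"
  shows "(osc_integral p has_derivative
           (\<lambda>h. 2 * of_real pi * \<i> * osc_integral (\<lambda>x. (h \<bullet> x) * p x) k)) (at k)"
proof -
  have [measurable]: "p \<in> borel_measurable borel" by (rule all_moments_measurable[OF p])
  define D where "D h = 2 * of_real pi * \<i> * osc_integral (\<lambda>x. (h \<bullet> x) * p x) k" for h
  define M where "M = 2 * pi\<^sup>2 * (LINT x|lborel. (norm x)\<^sup>2 * \<bar>p x\<bar>)"
  have int: "integrable lborel (\<lambda>x. osc k' x * of_real (p x))" for k'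
    by (rule integrable_osc[OF p])
  have int2: "integrable lborel (\<lambda>x. osc k x * of_real ((h \<bullet> x) * p x))" for h
    by (rule integrable_osc[OF all_moments_inner_mult[OF p]])
  have D: "D h = (LINT x|lborel. 2 * of_real pi * \<i> * (osc k x * of_real ((h \<bullet> x) * p x)))" for h
    unfolding D_def osc_integral_def by (rule integral_mult_right_zero [symmetric])
  have bnd: "norm (osc_integral p (k + h) - osc_integral p k - D h) \<le> M * (norm h)\<^sup>2" for h
  proof -
    have int3: "integrable lborel (\<lambda>x. 2 * of_real pi * \<i> * (osc k x * of_real ((h \<bullet> x) * p x)))"
      using int2 by (rule integrable_mult_right)
    have i4: "integrable lborel (\<lambda>x. osc (k + h) x * of_real (p x) - osc k x * of_real (p x)
              - 2 * of_real pi * \<i> * (osc k x * of_real ((h \<bullet> x) * p x)))"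
      by (intro Bochner_Integration.integrable_diff int int3)
    have "osc_integral p (k + h) - osc_integral p k - D h
        = (LINT x|lborel. osc (k + h) x * of_real (p x) - osc k x * of_real (p x)
              - 2 * of_real pi * \<i> * (osc k x * of_real ((h \<bullet> x) * p x)))"
      unfolding D osc_integral_def
      using int int3 by (simp add: Bochner_Integration.integral_diff Bochner_Integration.integrable_diff)
    also have "norm \<dots> \<le> (LINT x|lborel. 2 * pi\<^sup>2 * (norm h)\<^sup>2 * ((norm x)\<^sup>2 * \<bar>p x\<bar>))"
    proof (rule Bochner_Integration.integral_norm_bound_integral[OF i4])
      show "integrable lborel (\<lambda>x. 2 * pi\<^sup>2 * (norm h)\<^sup>2 * ((norm x)\<^sup>2 * \<bar>p x\<bar>))"
      proof (rule integrable_all_moments_bound[OF p, where N = 2 and C = "2 * pi\<^sup>2 * (norm h)\<^sup>2"])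
        fix x :: 'a
        have "(norm x)\<^sup>2 \<le> (1 + norm x)\<^sup>2" by (intro power_mono) auto
        then have "2 * pi\<^sup>2 * (norm h)\<^sup>2 * ((norm x)\<^sup>2 * \<bar>p x\<bar>) \<le> 2 * pi\<^sup>2 * (norm h)\<^sup>2 * ((1 + norm x)\<^sup>2 * \<bar>p x\<bar>)"
          by (intro mult_left_mono mult_right_mono) auto
        then show "norm (2 * pi\<^sup>2 * (norm h)\<^sup>2 * ((norm x)\<^sup>2 * \<bar>p x\<bar>)) \<le> 2 * pi\<^sup>2 * (norm h)\<^sup>2 * (1 + norm x)\<^sup>2 * \<bar>p x\<bar>"
          by (simp add: abs_mult mult.assoc)
      qed simp
      fix x
      have "osc (k + h) x * of_real (p x) - osc k x * of_real (p x)
              - 2 * of_real pi * \<i> * (osc k x * of_real ((h \<bullet> x) * p x))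
          = (osc (k + h) x - osc k x - 2 * of_real pi * \<i> * of_real (h \<bullet> x) * osc k x) * of_real (p x)"
        by (simp add: algebra_simps)
      then show "norm (osc (k + h) x * of_real (p x) - osc k x * of_real (p x)
              - 2 * of_real pi * \<i> * (osc k x * of_real ((h \<bullet> x) * p x)))
          \<le> 2 * pi\<^sup>2 * (norm h)\<^sup>2 * ((norm x)\<^sup>2 * \<bar>p x\<bar>)"
        using mult_right_mono[OF osc_first_order[of k h x], of "\<bar>p x\<bar>"]
        by (simp add: norm_mult mult.assoc)
    qed
    also have "\<dots> = M * (norm h)\<^sup>2" by (simp add: M_def)
    finally show ?thesis .
  qed
  have "((\<lambda>h. norm (osc_integral p (k + h) - osc_integral p k - D h) / norm h) \<longlongrightarrow> 0) (at 0)"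
  proof (rule Lim_null_comparison)
    show "\<forall>\<^sub>F h in at 0. norm (norm (osc_integral p (k + h) - osc_integral p k - D h) / norm h) \<le> M * norm h"
    proof (rule eventually_mono[OF eventually_neq_at_within[of 0]])
      fix h :: 'a assume "h \<noteq> 0"
      then show "norm (norm (osc_integral p (k + h) - osc_integral p k - D h) / norm h) \<le> M * norm h"
        using bnd[of h] by (simp add: divide_le_eq power2_eq_square mult.assoc)
    qed
    show "((\<lambda>h. M * norm h) \<longlongrightarrow> 0) (at 0)"
      by (rule tendsto_eq_intros refl | simp)+
  qed
  moreover have "bounded_linear D"
    unfolding D_def using osc_integral_linear[OF p] by (rule bounded_linear_const_mult)
  ultimately show ?thesis
    by (simp add: has_derivative_at D_def [symmetric])
qed

lemma osc_integral_inner_expand: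
  assumes p: "all_moments p"
  shows "osc_integral (\<lambda>x. (h \<bullet> x) * p x) k
       = (\<Sum>b\<in>Basis. of_real (h \<bullet> b) * osc_integral (\<lambda>x. (b \<bullet> x) * p x) k)"
proof -
  interpret bounded_linear "\<lambda>h. osc_integral (\<lambda>x. (h \<bullet> x) * p x) k"
    by (rule osc_integral_linear[OF p])
  have "osc_integral (\<lambda>x. (h \<bullet> x) * p x) k
      = osc_integral (\<lambda>x. ((\<Sum>b\<in>Basis. (h \<bullet> b) *\<^sub>R b) \<bullet> x) * p x) k"
    by (simp only: euclidean_representation)
  also have "\<dots> = (\<Sum>b\<in>Basis. of_real (h \<bullet> b) * osc_integral (\<lambda>x. (b \<bullet> x) * p x) k)"
    by (simp only: sum scaleR) (simp add: scaleR_conv_of_real)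
  finally show ?thesis .
qed

lemma continuous_osc_integral:
  assumes "all_moments p" "continuous_on S f"
  shows "continuous_on S (\<lambda>s. osc_integral p (f s))"
  by (rule continuous_on_compose2[OF _ assms(2), of UNIV])
     (auto intro!: has_derivative_continuous_on osc_integral_has_derivative assms)

section \<open>Gaussian test functions\<close>

lemma
  fixes f :: "'a::euclidean_space \<Rightarrow> real \<Rightarrow> 'b::{real_normed_field, banach, second_countable_topology}"
  assumes int: "\<And>b. b \<in> Basis \<Longrightarrow> integrable lborel (f b)"
  shows integrable_lborel_prod: "integrable lborel (\<lambda>x. \<Prod>b\<in>Basis. f b (x \<bullet> b))" (is ?A)
    and integral_lborel_prod:
      "(LINT x|lborel. (\<Prod>b\<in>Basis. f b (x \<bullet> b))) = (\<Prod>b\<in>Basis. (LINT x|lborel. f b x))" (is ?B)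
proof -
  interpret product_sigma_finite "\<lambda>_::'a. lborel :: real measure" ..
  have [measurable]: "f b \<in> borel_measurable borel" if "b \<in> Basis" for b
    using borel_measurable_integrable[OF int[OF that]] by simp
  have m: "(\<lambda>x. \<Prod>b\<in>Basis. f b (x \<bullet> b)) \<in> borel_measurable borel" by measurable
  have eq: "(\<Prod>b\<in>Basis. f b ((\<Sum>c\<in>Basis. g c *\<^sub>R c) \<bullet> b)) = (\<Prod>b\<in>Basis. f b (g b))" for g
    by (intro prod.cong refl) simp
  show ?A
    by (subst lborel_eq, subst integrable_distr_eq) (use m in \<open>auto simp: eq intro!: product_integrable_prod int\<close>)
  show ?B
    by (subst lborel_eq, subst integral_distr) (use m in \<open>auto simp: eq intro!: product_integral_prod int\<close>)
qed

text \<open>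
  The weight is dominated by the product over the coordinates of the integrable functions
  \<open>1 / (1 + (x \<bullet> b)\<^sup>2)\<close>.
\<close>

lemma integrable_inverse_one_plus_norm_power:
  "integrable lborel (\<lambda>x::'a::euclidean_space. inverse ((1 + norm x) ^ (2 * DIM('a))))"
proof (rule Bochner_Integration.integrable_bound)
  have "integrable lborel (\<lambda>x::real. inverse (1 + x\<^sup>2))"
    using integrable_inverse_1_plus_square by (simp add: set_integrable_def)
  then show "integrable lborel (\<lambda>x::'a. \<Prod>b\<in>Basis. inverse (1 + (x \<bullet> b)\<^sup>2))"
    by (rule integrable_lborel_prod)
  show "AE x::'a in lborel. norm (inverse ((1 + norm x) ^ (2 * DIM('a))))
           \<le> norm (\<Prod>b\<in>Basis. inverse (1 + (x \<bullet> b)\<^sup>2))"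
  proof (rule AE_I2)
    fix x :: 'a
    have "1 + (x \<bullet> b)\<^sup>2 \<le> (1 + norm x)\<^sup>2" if "b \<in> Basis" for b
    proof -
      have "(x \<bullet> b)\<^sup>2 \<le> (norm x)\<^sup>2"
        using Basis_le_norm[OF that, of x] by (metis abs_le_square_iff abs_norm_cancel)
      moreover have "(1 + norm x)\<^sup>2 = 1 + (norm x)\<^sup>2 + 2 * norm x" by (simp add: power2_sum)
      ultimately show ?thesis using norm_ge_zero[of x] by linarith
    qed
    then have "(\<Prod>b\<in>(Basis::'a set). 1 + (x \<bullet> b)\<^sup>2) \<le> (\<Prod>b\<in>(Basis::'a set). (1 + norm x)\<^sup>2)"
      by (intro prod_mono) auto
    also have "\<dots> = (1 + norm x) ^ (2 * DIM('a))" by (simp add: power_mult)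
    finally have le: "(\<Prod>b\<in>(Basis::'a set). 1 + (x \<bullet> b)\<^sup>2) \<le> (1 + norm x) ^ (2 * DIM('a))" .
    have pos: "0 < (\<Prod>b\<in>(Basis::'a set). 1 + (x \<bullet> b)\<^sup>2)"
      by (intro prod_pos) (auto intro: add_pos_nonneg)
    have "inverse ((1 + norm x) ^ (2 * DIM('a))) \<le> (\<Prod>b\<in>(Basis::'a set). inverse (1 + (x \<bullet> b)\<^sup>2))"
      using le_imp_inverse_le[OF le pos] by (simp add: prod_inversef [symmetric] o_def)
    then show "norm (inverse ((1 + norm x) ^ (2 * DIM('a)))) \<le> norm (\<Prod>b\<in>(Basis::'a set). inverse (1 + (x \<bullet> b)\<^sup>2))"
      by simp
  qed
qed simp

lemma all_moments_rapid_decay: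
  fixes p :: "'a::euclidean_space \<Rightarrow> real"
  assumes m: "p \<in> borel_measurable borel"
    and b: "\<And>N. bounded (range (\<lambda>x. (1 + norm x) ^ N * p x))"
  shows "all_moments p"
  unfolding all_moments_def
proof
  fix N
  obtain C where C: "\<And>x. \<bar>(1 + norm x) ^ (N + 2 * DIM('a)) * p x\<bar> \<le> C"
    using b[of "N + 2 * DIM('a)"] by (auto simp: bounded_iff)
  show "integrable lborel (\<lambda>x. (1 + norm x) ^ N * p x)"
  proof (rule Bochner_Integration.integrable_bound)
    show "integrable lborel (\<lambda>x::'a. C * inverse ((1 + norm x) ^ (2 * DIM('a))))"
      by (intro integrable_mult_right integrable_inverse_one_plus_norm_power)
    show "AE x in lborel. norm ((1 + norm x) ^ N * p x) \<le> norm (C * inverse ((1 + norm x) ^ (2 * DIM('a))))"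
    proof (rule AE_I2)
      fix x :: 'a
      have "0 < (1 + norm x) ^ (2 * DIM('a))" by (simp add: add_pos_nonneg)
      then have "\<bar>(1 + norm x) ^ N * p x\<bar> \<le> C * inverse ((1 + norm x) ^ (2 * DIM('a)))"
        using C[of x] by (simp add: power_add abs_mult field_simps)
      then show "norm ((1 + norm x) ^ N * p x) \<le> norm (C * inverse ((1 + norm x) ^ (2 * DIM('a))))"
        by (simp add: order_trans[OF _ abs_ge_self])
    qed
  qed (use m in measurable)
qed

text \<open>
  The Gaussian without its normalising factor.
\<close>

definition gaussian :: "'a::euclidean_space \<Rightarrow> real" where
  "gaussian x = exp (- (x \<bullet> x) / 2)"

lemma gaussian_eq_prod:
  fixes x :: "'a::euclidean_space"
  shows "gaussian x = sqrt (2 * pi) ^ DIM('a) * (\<Prod>b\<in>Basis. std_normal_density (x \<bullet> b))"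
proof -
  have "(\<Prod>b\<in>(Basis::'a set). std_normal_density (x \<bullet> b))
      = (1 / sqrt (2 * pi)) ^ DIM('a) * exp (\<Sum>b\<in>(Basis::'a set). - (x \<bullet> b)\<^sup>2 / 2)"
    unfolding std_normal_density_def prod.distrib by (simp only: exp_sum finite_Basis prod_constant)
  also have "(\<Sum>b\<in>(Basis::'a set). - (x \<bullet> b)\<^sup>2 / 2) = - (x \<bullet> x) / 2"
    by (simp add: euclidean_inner[of x x] sum_negf sum_divide_distrib power2_eq_square)
  finally show ?thesis
    by (simp add: gaussian_def power_divide del: real_sqrt_mult)
qed

lemma osc_eq_prod: "osc k x = (\<Prod>b\<in>Basis. iexp (2 * pi * (k \<bullet> b) * (x \<bullet> b)))"
  by (simp add: osc_def euclidean_inner[of k x] exp_sum [symmetric] sum_distrib_left mult_ac)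

lemma osc_integral_gaussian:
  fixes k :: "'a::euclidean_space"
  shows "osc_integral gaussian k = of_real (sqrt (2 * pi) ^ DIM('a) * exp (- 2 * pi\<^sup>2 * (k \<bullet> k)))"
proof -
  have int: "integrable lborel (\<lambda>x. iexp (2 * pi * (k \<bullet> b) * x) * of_real (std_normal_density x))" for b
  proof -
    have "integrable lborel (\<lambda>x. complex_of_real (std_normal_density x))"
      using integrable_normal_density[of 1 0] by simp
    then show ?thesis
      by (rule Bochner_Integration.integrable_bound) (auto simp: norm_mult)
  qed
  have char: "(LINT x|lborel. iexp (2 * pi * (k \<bullet> b) * x) * of_real (std_normal_density x))
      = of_real (exp (- (2 * pi * (k \<bullet> b))\<^sup>2 / 2))" for b
  proof -
    have "(LINT x|lborel. iexp (2 * pi * (k \<bullet> b) * x) * of_real (std_normal_density x))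
        = char std_normal_distribution (2 * pi * (k \<bullet> b))"
      unfolding char_def
      by (subst integral_density) (auto simp: scaleR_conv_of_real mult_ac)
    then show ?thesis by (simp add: char_std_normal_distribution)
  qed
  have "osc_integral gaussian k = (LINT x|lborel. of_real (sqrt (2 * pi) ^ DIM('a))
      * (\<Prod>b\<in>Basis. iexp (2 * pi * (k \<bullet> b) * (x \<bullet> b)) * of_real (std_normal_density (x \<bullet> b))))"
    unfolding osc_integral_def
    by (intro Bochner_Integration.integral_cong refl)
       (simp add: osc_eq_prod gaussian_eq_prod prod.distrib mult_ac del: real_sqrt_mult)
  also have "\<dots> = of_real (sqrt (2 * pi) ^ DIM('a)) * (\<Prod>b\<in>(Basis::'a set). of_real (exp (- (2 * pi * (k \<bullet> b))\<^sup>2 / 2)))"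
    using integral_lborel_prod[where f = "\<lambda>b x. iexp (2 * pi * (k \<bullet> b) * x) * of_real (std_normal_density x)", OF int]
    by (subst integral_mult_right_zero) (simp only: char)
  also have "(\<Prod>b\<in>(Basis::'a set). complex_of_real (exp (- (2 * pi * (k \<bullet> b))\<^sup>2 / 2)))
      = of_real (exp (- 2 * pi\<^sup>2 * (k \<bullet> k)))"
  proof -
    have "(\<Sum>b\<in>(Basis::'a set). - (2 * pi * (k \<bullet> b))\<^sup>2 / 2) = - 2 * pi\<^sup>2 * (k \<bullet> k)"
      by (simp add: euclidean_inner[of k k] sum_distrib_left power2_eq_square mult_ac sum_negf)
    then show ?thesis by (simp flip: of_real_prod exp_sum)
  qed
  finally show ?thesis by simp
qed

lemma one_plus_power_gaussian_bounded:
  "bounded (range (\<lambda>x::'a::euclidean_space. (1 + norm x) ^ N * gaussian x))"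
proof -
  have "((\<lambda>r::real. (1 + r) ^ N * exp (- (r\<^sup>2) / 2)) \<longlongrightarrow> 0) at_top"
    by real_asymp
  then have "\<forall>\<^sub>F r in at_top. (1 + r) ^ N * exp (- (r\<^sup>2) / 2) < (1::real)"
    by (rule order_tendstoD) simp
  then obtain R where R: "\<And>r::real. r \<ge> R \<Longrightarrow> (1 + r) ^ N * exp (- (r\<^sup>2) / 2) < 1"
    by (auto simp: eventually_at_top_linorder)
  have "(1 + norm x) ^ N * gaussian x \<le> max 1 ((1 + max R 0) ^ N)" for x :: 'a
  proof (cases "norm x \<ge> R")
    case True
    then have "(1 + norm x) ^ N * gaussian x < 1"
      using R[of "norm x"] by (simp add: gaussian_def power2_norm_eq_inner)
    then show ?thesis by linarith
  next
    case False
    have "(1 + norm x) ^ N * gaussian x \<le> (1 + max R 0) ^ N * 1"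
      using False by (intro mult_mono power_mono) (auto simp: gaussian_def)
    then show ?thesis by simp
  qed
  then show ?thesis
    by (auto simp: bounded_iff abs_mult gaussian_def intro!: exI[of _ "max 1 ((1 + max R 0) ^ N)"])
qed

lemma real_polynomial_function_growth:
  assumes "real_polynomial_function p"
  shows "\<exists>C N. 0 \<le> C \<and> (\<forall>x. \<bar>p x\<bar> \<le> C * (1 + norm x) ^ N)"
  using assms
proof induction
  case (linear f)
  then interpret bounded_linear f .
  obtain K where K: "\<And>x. norm (f x) \<le> norm x * K" "K > 0" using pos_bounded by blast
  have "\<bar>f x\<bar> \<le> K * (1 + norm x) ^ 1" for x
    using K(1)[of x] K(2) by (simp add: algebra_simps)
  then show ?case using K(2) by (intro exI[of _ K] exI[of _ 1]) auto
next
  case (const c)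
  show ?case by (intro exI[of _ "\<bar>c\<bar>"] exI[of _ 0]) auto
next
  case (add f g)
  then obtain C N C' N' where *: "0 \<le> C" "\<And>x. \<bar>f x\<bar> \<le> C * (1 + norm x) ^ N"
    "0 \<le> C'" "\<And>x. \<bar>g x\<bar> \<le> C' * (1 + norm x) ^ N'" by blast
  have "\<bar>f x + g x\<bar> \<le> (C + C') * (1 + norm x) ^ (N + N')" for x
  proof -
    have "C * (1 + norm x) ^ N \<le> C * (1 + norm x) ^ (N + N')"
      "C' * (1 + norm x) ^ N' \<le> C' * (1 + norm x) ^ (N + N')"
      using * by (intro mult_left_mono power_increasing; simp)+
    then show ?thesis using *(2,4)[of x] by (simp add: distrib_right)
  qed
  then show ?case using * by (intro exI[of _ "C + C'"] exI[of _ "N + N'"]) auto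
next
  case (mult f g)
  then obtain C N C' N' where *: "0 \<le> C" "\<And>x. \<bar>f x\<bar> \<le> C * (1 + norm x) ^ N"
    "0 \<le> C'" "\<And>x. \<bar>g x\<bar> \<le> C' * (1 + norm x) ^ N'" by blast
  have "\<bar>f x * g x\<bar> \<le> (C * C') * (1 + norm x) ^ (N + N')" for x
    using mult_mono[OF *(2,4)[of x]] * by (simp add: abs_mult power_add mult_ac)
  then show ?case using * by (intro exI[of _ "C * C'"] exI[of _ "N + N'"]) auto
qed

text \<open>
  Directional derivatives of polynomials are polynomials.
\<close>

lemma real_polynomial_function_has_derivative:
  assumes "real_polynomial_function (p :: 'a::real_normed_vector \<Rightarrow> real)"
  shows "\<exists>p'. real_polynomial_function p' \<and>
           (\<forall>x. p differentiable (at x) \<and> frechet_derivative p (at x) v = p' x)"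
  using assms
proof induction
  case (linear f)
  have d: "(f has_derivative f) (at x)" for x by (rule bounded_linear_imp_has_derivative[OF linear])
  show ?case
    by (rule exI[of _ "\<lambda>x. f v"]) (use frechet_derivative_at[OF d, symmetric] d in \<open>auto simp: differentiable_def\<close>)
next
  case (const c)
  show ?case by (rule exI[of _ "\<lambda>x. 0"]) auto
next
  case (add f g)
  then obtain f' g' where *: "real_polynomial_function f'" "real_polynomial_function g'"
    "\<And>x. f differentiable (at x)" "\<And>x. g differentiable (at x)"
    "\<And>x. frechet_derivative f (at x) v = f' x" "\<And>x. frechet_derivative g (at x) v = g' x" by blast
  show ?case
    using * by (intro exI[of _ "\<lambda>x. f' x + g' x"])
      (auto simp: differentiable_add fun_eq_iff
        frechet_derivative_at[OF has_derivative_add[OF frechet_derivative_works[THEN iffD1] frechet_derivative_works[THEN iffD1]], symmetric])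
next
  case (mult f g)
  then obtain f' g' where *: "real_polynomial_function f'" "real_polynomial_function g'"
    "\<And>x. f differentiable (at x)" "\<And>x. g differentiable (at x)"
    "\<And>x. frechet_derivative f (at x) v = f' x" "\<And>x. frechet_derivative g (at x) v = g' x" by blast
  have d: "((\<lambda>x. f x * g x) has_derivative
      (\<lambda>h. f x * frechet_derivative g (at x) h + frechet_derivative f (at x) h * g x)) (at x)" for x
    using *(3,4) by (intro has_derivative_mult) (auto simp: frechet_derivative_works)
  have "frechet_derivative (\<lambda>x. f x * g x) (at x) v = f x * g' x + f' x * g x" for x
    using fun_cong[OF frechet_derivative_at[OF d, symmetric], of x v] *(5,6) by simp
  moreover have "(\<lambda>x. f x * g x) differentiable (at x)" for x
    using d by (auto simp: differentiable_def)
  ultimately show ?case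
    using * mult.hyps by (intro exI[of _ "\<lambda>x. f x * g' x + f' x * g x"]) auto
qed

lemma partial_derivs_polynomial_gaussian:
  assumes "real_polynomial_function p"
  shows "\<exists>p'. real_polynomial_function p' \<and>
           partial_derivs js (\<lambda>x. (p x * gaussian x) *\<^sub>R v) = (\<lambda>x. (p' x * gaussian x) *\<^sub>R v)"
proof (induction js)
  case Nil
  then show ?case using assms by auto
next
  case (Cons j js)
  then obtain p' where p': "real_polynomial_function p'"
    "partial_derivs js (\<lambda>x. (p x * gaussian x) *\<^sub>R v) = (\<lambda>x. (p' x * gaussian x) *\<^sub>R v)" by blast
  obtain p'' where p'': "real_polynomial_function p''" "\<And>x. p' differentiable (at x)"
    "\<And>x. frechet_derivative p' (at x) (axis j 1) = p'' x"
    using real_polynomial_function_has_derivative[OF p'(1), of "axis j 1"] by blast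
  have g: "(gaussian has_derivative (\<lambda>h. - (x \<bullet> h) * gaussian x)) (at x)" for x :: "real^3"
    unfolding gaussian_def [abs_def]
    by (auto intro!: derivative_eq_intros simp: inner_commute algebra_simps)
  have "((\<lambda>x. (p' x * gaussian x) *\<^sub>R v) has_derivative
      (\<lambda>h. (p' x * (- (x \<bullet> h) * gaussian x) + frechet_derivative p' (at x) h * gaussian x) *\<^sub>R v)) (at x)" for x
    using p''(2) g by (intro has_derivative_scaleR_left has_derivative_mult) (auto simp: frechet_derivative_works)
  from frechet_derivative_at[OF this, symmetric]
  have "frechet_derivative (\<lambda>x. (p' x * gaussian x) *\<^sub>R v) (at x) (axis j 1)
      = ((p'' x - (x $ j) * p' x) * gaussian x) *\<^sub>R v" for x
    by (simp add: p''(3) inner_axis algebra_simps)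
  moreover have "real_polynomial_function (\<lambda>x::real^3. x $ j)"
    by (intro real_polynomial_function.intros(1) bounded_linear_vec_nth)
  then have "real_polynomial_function (\<lambda>x. p'' x - (x $ j) * p' x)"
    using p' p'' by auto
  ultimately show ?case using p'(2) by auto
qed

text \<open>
  Partial derivatives of a polynomial times the Gaussian have the same form, so only the boundedness of such a
  product has to be verified.
\<close>

lemma schwartz_polynomial_gaussian:
  assumes "real_polynomial_function p"
  shows "(\<lambda>x. (p x * gaussian x) *\<^sub>R v) \<in> schwartz"
  unfolding schwartz_def
proof (safe)
  fix js
  obtain p' where p': "real_polynomial_function p'"
    "partial_derivs js (\<lambda>x. (p x * gaussian x) *\<^sub>R v) = (\<lambda>x. (p' x * gaussian x) *\<^sub>R v)"
    using partial_derivs_polynomial_gaussian[OF assms] by blast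
  have "p' differentiable (at x)" for x
    using real_polynomial_function_has_derivative[OF p'(1)] by blast
  moreover have "gaussian differentiable (at x)" for x :: "real^3"
    unfolding gaussian_def [abs_def] differentiable_def by (auto intro!: derivative_eq_intros exI)
  ultimately show "partial_derivs js (\<lambda>x. (p x * gaussian x) *\<^sub>R v) differentiable (at x)" for x
    unfolding p'(2) by (intro differentiable_scaleR differentiable_mult) auto
  fix N
  obtain C M where C: "0 \<le> C" "\<And>x. \<bar>p' x\<bar> \<le> C * (1 + norm x) ^ M"
    using real_polynomial_function_growth[OF p'(1)] by blast
  obtain K where K: "\<And>x::real^3. \<bar>(1 + norm x) ^ (N + M) * gaussian x\<bar> \<le> K"
    using one_plus_power_gaussian_bounded[of "N + M"] by (auto simp: bounded_iff)
  have "norm ((1 + norm x) ^ N *\<^sub>R (p' x * gaussian x) *\<^sub>R v) \<le> C * K * norm v" for x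
  proof -
    have "norm ((1 + norm x) ^ N *\<^sub>R (p' x * gaussian x) *\<^sub>R v)
        = (1 + norm x) ^ N * \<bar>gaussian x\<bar> * \<bar>p' x\<bar> * norm v" by (simp add: abs_mult)
    also have "\<dots> \<le> (1 + norm x) ^ N * \<bar>gaussian x\<bar> * (C * (1 + norm x) ^ M) * norm v"
      using C(2)[of x] by (intro mult_right_mono mult_left_mono) auto
    also have "\<dots> = C * \<bar>(1 + norm x) ^ (N + M) * gaussian x\<bar> * norm v"
      by (simp add: power_add abs_mult mult_ac)
    also have "\<dots> \<le> C * K * norm v" using K[of x] C(1) by (intro mult_right_mono mult_left_mono) auto
    finally show ?thesis .
  qed
  then show "bounded (range (\<lambda>x. (1 + norm x) ^ N *\<^sub>R partial_derivs js (\<lambda>x. (p x * gaussian x) *\<^sub>R v) x))"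
    unfolding p'(2) by (auto simp: bounded_iff)
qed

section \<open>Tempered distributions and weak* differentiability\<close>

lemma schwartz_differentiable:
  assumes "\<psi> \<in> schwartz" shows "\<psi> differentiable (at x)"
  using assms unfolding schwartz_def by (metis (mono_tags, lifting) mem_Collect_eq partial_derivs.simps(1))

lemma schwartz_bounded:
  assumes "\<psi> \<in> schwartz"
  shows "bounded (range (\<lambda>x. (1 + norm x) ^ N *\<^sub>R partial_derivs js \<psi> x))"
  using assms unfolding schwartz_def by blast

lemma schwartz_continuous:
  assumes "\<psi> \<in> schwartz" shows "continuous_on UNIV \<psi>"
  using schwartz_differentiable[OF assms]
  by (intro differentiable_imp_continuous_on) (simp add: differentiable_on_def)

lemma schwartz_all_moments:
  assumes "\<psi> \<in> schwartz" shows "all_moments (\<lambda>x. \<psi> x $ j)"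
proof (rule all_moments_rapid_decay)
  show "(\<lambda>x. \<psi> x $ j) \<in> borel_measurable borel"
    by (intro borel_measurable_continuous_onI continuous_intros schwartz_continuous assms)
  fix N
  obtain K where K: "\<And>x. norm ((1 + norm x) ^ N *\<^sub>R \<psi> x) \<le> K"
    using schwartz_bounded[OF assms, of N "[]"] by (auto simp: bounded_iff)
  have "\<bar>(1 + norm x) ^ N * \<psi> x $ j\<bar> \<le> K" for x
    using order_trans[OF component_le_norm_cart[of "(1 + norm x) ^ N *\<^sub>R \<psi> x" j] K[of x]] by simp
  then show "bounded (range (\<lambda>x. (1 + norm x) ^ N * \<psi> x $ j))"
    by (auto simp: bounded_iff)
qed

lemma schwartz_bdd_above:
  assumes "\<psi> \<in> schwartz"
  shows "bdd_above (range (\<lambda>x. (1 + norm x) ^ N * norm (partial_derivs js \<psi> x)))"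
proof -
  obtain K where K: "\<And>x. norm ((1 + norm x) ^ N *\<^sub>R partial_derivs js \<psi> x) \<le> K"
    using schwartz_bounded[OF assms, of N js] by (auto simp: bounded_iff)
  show ?thesis
  proof (rule bdd_aboveI2)
    show "(1 + norm x) ^ N * norm (partial_derivs js \<psi> x) \<le> K" for x using K[of x] by simp
  qed
qed

lemma finite_lists_3: "finite {js :: 3 list. length js \<le> N}"
  using finite_lists_length_le[of "UNIV :: 3 set" N] by simp

lemma schwartz_sup_nonneg:
  assumes "\<psi> \<in> schwartz"
  shows "0 \<le> (SUP x. (1 + norm x) ^ N * norm (partial_derivs js \<psi> x))"
  by (rule cSUP_upper2[OF schwartz_bdd_above[OF assms], of 0]) auto

lemma schwartz_seminorm_nonneg:
  assumes "\<psi> \<in> schwartz" shows "0 \<le> schwartz_seminorm N \<psi>"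
  unfolding schwartz_seminorm_def by (intro sum_nonneg schwartz_sup_nonneg assms)

lemma schwartz_seminorm_mono:
  assumes "\<psi> \<in> schwartz" "N \<le> N'" shows "schwartz_seminorm N \<psi> \<le> schwartz_seminorm N' \<psi>"
  unfolding schwartz_seminorm_def
proof (rule order_trans[OF sum_mono sum_mono2])
  show "(SUP x. (1 + norm x) ^ N * norm (partial_derivs js \<psi> x))
      \<le> (SUP x. (1 + norm x) ^ N' * norm (partial_derivs js \<psi> x))" for js
    using assms(2)
    by (intro cSUP_mono schwartz_bdd_above[OF assms(1)])
       (auto intro!: exI mult_right_mono power_increasing)
qed (use assms schwartz_sup_nonneg finite_lists_3 in auto)

lemma schwartz_decay:
  assumes "\<psi> \<in> schwartz" shows "(1 + norm x) ^ N * norm (\<psi> x) \<le> schwartz_seminorm N \<psi>"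
proof -
  have "(1 + norm x) ^ N * norm (\<psi> x) \<le> (SUP x. (1 + norm x) ^ N * norm (partial_derivs [] \<psi> x))"
    using cSUP_upper[OF UNIV_I schwartz_bdd_above[OF assms, of N "[]"]] by simp
  also have "\<dots> \<le> schwartz_seminorm N \<psi>"
    unfolding schwartz_seminorm_def
    by (rule member_le_sum) (auto simp: finite_lists_3 schwartz_sup_nonneg assms)
  finally show ?thesis .
qed

lemma
  assumes "\<psi> \<in> schwartz" "\<psi>' \<in> schwartz"
  shows partial_derivs_add:
      "partial_derivs js (\<lambda>x. \<psi> x + \<psi>' x) = (\<lambda>x. partial_derivs js \<psi> x + partial_derivs js \<psi>' x)"
    and schwartz_add: "(\<lambda>x. \<psi> x + \<psi>' x) \<in> schwartz"
proof -
  have d: "partial_derivs js \<psi> differentiable (at x)" "partial_derivs js \<psi>' differentiable (at x)" for js x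
    using assms unfolding schwartz_def by blast+
  show *: "partial_derivs js (\<lambda>x. \<psi> x + \<psi>' x) = (\<lambda>x. partial_derivs js \<psi> x + partial_derivs js \<psi>' x)" for js
  proof (induction js)
    case (Cons j js)
    show ?case
      by (simp only: partial_derivs.simps Cons fun_eq_iff)
         (simp add: frechet_derivative_at[OF has_derivative_add[OF frechet_derivative_works[THEN iffD1, OF d(1)]
            frechet_derivative_works[THEN iffD1, OF d(2)]], symmetric])
  qed simp
  have "bounded (range (\<lambda>x. (1 + norm x) ^ N *\<^sub>R (partial_derivs js \<psi> x + partial_derivs js \<psi>' x)))" for N js
    unfolding scaleR_add_right by (intro bounded_plus_comp schwartz_bounded assms)
  then show "(\<lambda>x. \<psi> x + \<psi>' x) \<in> schwartz"
    by (simp add: schwartz_def * d differentiable_add)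
qed

lemma schwartz_scaleR:
  assumes "\<psi> \<in> schwartz" shows "(\<lambda>x. c *\<^sub>R \<psi> x) \<in> schwartz"
proof -
  have d: "partial_derivs js \<psi> differentiable (at x)" for js x
    using assms unfolding schwartz_def by blast
  have *: "partial_derivs js (\<lambda>x. c *\<^sub>R \<psi> x) = (\<lambda>x. c *\<^sub>R partial_derivs js \<psi> x)" for js
  proof (induction js)
    case (Cons j js)
    show ?case
      by (simp only: partial_derivs.simps Cons fun_eq_iff)
         (simp add: frechet_derivative_at[OF has_derivative_scaleR_right[OF frechet_derivative_works[THEN iffD1, OF d]], symmetric])
  qed simp
  have "bounded (range (\<lambda>x. c *\<^sub>R ((1 + norm x) ^ N *\<^sub>R partial_derivs js \<psi> x)))" for N js
    by (intro bounded_scaleR_comp schwartz_bounded assms)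
  then show ?thesis
    by (simp add: schwartz_def * d mult.commute)
qed

lemma norm_pairing_le:
  fixes v :: "complex^3" and w :: "real^3"
  shows "norm (\<Sum>j\<in>UNIV. v $ j * of_real (w $ j)) \<le> 3 * (norm v * norm w)"
proof -
  have "norm (\<Sum>j\<in>UNIV. v $ j * of_real (w $ j)) \<le> (\<Sum>j\<in>(UNIV::3 set). norm v * norm w)"
    by (rule sum_norm_le)
       (simp add: norm_mult, intro mult_mono component_le_norm_cart Finite_Cartesian_Product.norm_nth_le, simp_all)
  then show ?thesis by simp
qed

lemma regular_distribution_tempered:
  assumes cont: "continuous_on UNIV \<phi>"
    and growth: "\<And>x. norm (\<phi> x) \<le> C * (1 + norm x) ^ M"
  shows "regular_distribution \<phi> \<in> tempered"
proof -
  \<comment> \<open>the exponent 6 makes the weight integrable in dimension three\<close>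
  define w :: "real^3 \<Rightarrow> real" where "w x = inverse ((1 + norm x) ^ 6)" for x
  have int_w: "integrable lborel w"
    using integrable_inverse_one_plus_norm_power[where 'a = "real^3"] by (simp add: w_def [abs_def])
  define P where "P \<psi> x = (\<Sum>j\<in>UNIV. \<phi> x $ j * complex_of_real (\<psi> x $ j))" for \<psi> x
  have C: "0 \<le> C" using order_trans[OF norm_ge_zero growth[of 0]] by simp
  have bound: "norm (P \<psi> x) \<le> (3 * C * schwartz_seminorm (M + 6) \<psi>) * w x"
    if "\<psi> \<in> schwartz" for \<psi> x
  proof -
    have pos: "0 < 1 + norm x" by (simp add: add_pos_nonneg)
    have "norm (P \<psi> x) * (1 + norm x) ^ 6 \<le> 3 * (norm (\<phi> x) * norm (\<psi> x)) * (1 + norm x) ^ 6"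
      unfolding P_def by (intro mult_right_mono norm_pairing_le) simp
    also have "\<dots> \<le> 3 * (C * (1 + norm x) ^ M * norm (\<psi> x)) * (1 + norm x) ^ 6"
      by (intro mult_right_mono mult_left_mono growth) auto
    also have "\<dots> = 3 * C * ((1 + norm x) ^ (M + 6) * norm (\<psi> x))"
      by (simp add: power_add mult_ac)
    also have "\<dots> \<le> 3 * C * schwartz_seminorm (M + 6) \<psi>"
      using C by (intro mult_left_mono schwartz_decay that) auto
    finally show ?thesis using pos by (simp add: w_def field_simps)
  qed
  have int: "integrable lborel (P \<psi>)" if "\<psi> \<in> schwartz" for \<psi>
  proof (rule Bochner_Integration.integrable_bound)
    show "integrable lborel (\<lambda>x. (3 * C * schwartz_seminorm (M + 6) \<psi>) * w x)"
      by (intro integrable_mult_right int_w)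
    have "continuous_on UNIV (P \<psi>)"
      unfolding P_def by (intro continuous_intros cont schwartz_continuous that)
    then show "P \<psi> \<in> borel_measurable lborel" by (simp add: borel_measurable_continuous_onI)
    show "AE x in lborel. norm (P \<psi> x) \<le> norm ((3 * C * schwartz_seminorm (M + 6) \<psi>) * w x)"
      using bound[OF that] by (intro AE_I2) (metis abs_ge_self order_trans real_norm_def)
  qed
  \<comment> \<open>restriction to the Schwartz space is harmless since sums and multiples of test functions are test functions\<close>
  have R: "regular_distribution \<phi> \<psi> = (LINT x|lborel. P \<psi> x)" if "\<psi> \<in> schwartz" for \<psi>
    using that by (simp add: regular_distribution_def P_def)
  have "regular_distribution \<phi> (\<lambda>x. \<psi> x + \<psi>' x) = regular_distribution \<phi> \<psi> + regular_distribution \<phi> \<psi>'"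
    if "\<psi> \<in> schwartz" "\<psi>' \<in> schwartz" for \<psi> \<psi>'
  proof -
    have "P (\<lambda>x. \<psi> x + \<psi>' x) = (\<lambda>x. P \<psi> x + P \<psi>' x)"
      by (simp add: P_def fun_eq_iff distrib_left sum.distrib)
    then show ?thesis using that int by (simp add: R schwartz_add)
  qed
  moreover have "regular_distribution \<phi> (\<lambda>x. c *\<^sub>R \<psi> x) = of_real c * regular_distribution \<phi> \<psi>"
    if "\<psi> \<in> schwartz" for c \<psi>
  proof -
    have "P (\<lambda>x. c *\<^sub>R \<psi> x) = (\<lambda>x. of_real c * P \<psi> x)"
      by (simp add: P_def fun_eq_iff sum_distrib_left mult_ac)
    then show ?thesis using that by (simp add: R schwartz_scaleR)
  qed
  moreover have "norm (regular_distribution \<phi> \<psi>)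
      \<le> 3 * C * (LINT x|lborel. w x) * schwartz_seminorm (M + 6) \<psi>" if "\<psi> \<in> schwartz" for \<psi>
  proof -
    have "norm (LINT x|lborel. P \<psi> x) \<le> (LINT x|lborel. (3 * C * schwartz_seminorm (M + 6) \<psi>) * w x)"
      by (intro Bochner_Integration.integral_norm_bound_integral int that integrable_mult_right int_w bound)
    then show ?thesis using that by (simp add: R mult_ac)
  qed
  moreover have "regular_distribution \<phi> \<in> extensional schwartz"
    by (simp add: regular_distribution_def)
  ultimately show "regular_distribution \<phi> \<in> tempered"
    unfolding tempered_def by blast
qed

lemma tempered_extensional: "T \<in> tempered \<Longrightarrow> T \<in> extensional schwartz"
  by (simp add: tempered_def)

text \<open>
  For \<open>h = 0\<close> division by zero yields the zero functional, so no hypothesis on \<open>h\<close> is needed.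
\<close>

lemma tempered_difference_quotient:
  assumes "T \<in> tempered" "T' \<in> tempered"
  shows "(\<lambda>\<psi>\<in>schwartz. (T \<psi> - T' \<psi>) / of_real h) \<in> tempered"
proof -
  obtain C N C' N' where C: "\<And>\<psi>. \<psi> \<in> schwartz \<Longrightarrow> norm (T \<psi>) \<le> C * schwartz_seminorm N \<psi>"
    "\<And>\<psi>. \<psi> \<in> schwartz \<Longrightarrow> norm (T' \<psi>) \<le> C' * schwartz_seminorm N' \<psi>"
    using assms unfolding tempered_def by blast
  have "norm ((T \<psi> - T' \<psi>) / of_real h) \<le> (\<bar>C\<bar> + \<bar>C'\<bar>) / \<bar>h\<bar> * schwartz_seminorm (N + N') \<psi>"
    if \<psi>: "\<psi> \<in> schwartz" for \<psi>
  proof -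
    have "C * schwartz_seminorm N \<psi> \<le> \<bar>C\<bar> * schwartz_seminorm (N + N') \<psi>"
      using \<psi> by (intro mult_mono schwartz_seminorm_mono schwartz_seminorm_nonneg) auto
    moreover have "C' * schwartz_seminorm N' \<psi> \<le> \<bar>C'\<bar> * schwartz_seminorm (N + N') \<psi>"
      using \<psi> by (intro mult_mono schwartz_seminorm_mono schwartz_seminorm_nonneg) auto
    ultimately have "norm (T \<psi> - T' \<psi>) \<le> (\<bar>C\<bar> + \<bar>C'\<bar>) * schwartz_seminorm (N + N') \<psi>"
      using C[OF \<psi>] norm_triangle_ineq4[of "T \<psi>" "T' \<psi>"] by (simp add: distrib_right)
    then show ?thesis by (simp add: norm_divide divide_right_mono)
  qed
  moreover have "(T (\<lambda>x. \<psi> x + \<psi>' x) - T' (\<lambda>x. \<psi> x + \<psi>' x)) / of_real h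
      = (T \<psi> - T' \<psi>) / of_real h + (T \<psi>' - T' \<psi>') / of_real h"
    if "\<psi> \<in> schwartz" "\<psi>' \<in> schwartz" for \<psi> \<psi>'
    using assms that by (simp add: tempered_def add_divide_distrib diff_divide_distrib)
  moreover have "(T (\<lambda>x. c *\<^sub>R \<psi> x) - T' (\<lambda>x. c *\<^sub>R \<psi> x)) / of_real h = of_real c * ((T \<psi> - T' \<psi>) / of_real h)"
    if "\<psi> \<in> schwartz" for \<psi> c
    using assms that by (simp add: tempered_def diff_divide_distrib right_diff_distrib)
  ultimately show ?thesis
    unfolding tempered_def mem_Collect_eq
    by (intro conjI exI[of _ "(\<bar>C\<bar> + \<bar>C'\<bar>) / \<bar>h\<bar>"] exI[of _ "N + N'"] ballI allI)
       (simp_all only: restrict_extensional restrict_apply' schwartz_add schwartz_scaleR)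
qed

lemma limitin_weak_star:
  "limitin weak_star f T F \<longleftrightarrow>
     T \<in> tempered \<and> (\<forall>\<^sub>F a in F. f a \<in> tempered) \<and> (\<forall>\<psi>\<in>schwartz. ((\<lambda>a. f a \<psi>) \<longlongrightarrow> T \<psi>) F)"
  unfolding weak_star_def limitin_subtopology limitin_componentwise
  by (auto simp: PiE_iff tempered_extensional elim: eventually_mono)

lemma continuous_map_weak_star:
  "continuous_map euclideanreal weak_star f \<longleftrightarrow>
     (\<forall>t. f t \<in> tempered) \<and> (\<forall>\<psi>\<in>schwartz. continuous_on UNIV (\<lambda>t. f t \<psi>))"
  unfolding weak_star_def continuous_map_in_subtopology continuous_map_componentwise
  by (auto simp: tempered_extensional Pi_iff)

lemma has_vector_derivative_difference_quotient:
  fixes f :: "real \<Rightarrow> complex"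
  shows "(f has_vector_derivative f') (at t) \<longleftrightarrow>
    ((\<lambda>h. (f (t + h) - f t) / of_real h) \<longlongrightarrow> f') (at 0)"
proof -
  have "(f has_vector_derivative f') (at t) \<longleftrightarrow>
     ((\<lambda>h. norm (f (t + h) - f t - h *\<^sub>R f') / norm h) \<longlongrightarrow> 0) (at 0)"
    by (simp add: has_vector_derivative_def has_derivative_at bounded_linear_scaleR_left)
  also have "\<dots> \<longleftrightarrow> ((\<lambda>h. norm ((f (t + h) - f t) / of_real h - f')) \<longlongrightarrow> 0) (at 0)"
  proof (rule filterlim_cong[OF refl refl], rule eventually_mono[OF eventually_neq_at_within[of 0]])
    fix h :: real assume "h \<noteq> 0"
    then have "(f (t + h) - f t) / of_real h - f' = (f (t + h) - f t - h *\<^sub>R f') / of_real h"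
      by (simp add: field_simps scaleR_conv_of_real)
    then show "norm (f (t + h) - f t - h *\<^sub>R f') / norm h = norm ((f (t + h) - f t) / of_real h - f')"
      by (simp add: norm_divide)
  qed
  also have "\<dots> \<longleftrightarrow> ((\<lambda>h. (f (t + h) - f t) / of_real h) \<longlongrightarrow> f') (at 0)"
    by (simp add: tendsto_norm_zero_iff LIM_zero_iff)
  finally show ?thesis .
qed

text \<open>
  In the weak* topology differentiability and continuity are tested on one Schwartz function at a time.
\<close>

lemma C1_weak_star_iff:
  "C1_weak_star \<eta> \<eta>' \<longleftrightarrow>
     (\<forall>t. \<eta> t \<in> tempered) \<and> (\<forall>t. \<eta>' t \<in> tempered) \<and>
     (\<forall>\<psi>\<in>schwartz. (\<forall>t. ((\<lambda>s. \<eta> s \<psi>) has_vector_derivative \<eta>' t \<psi>) (at t)) \<and>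
                    continuous_on UNIV (\<lambda>t. \<eta>' t \<psi>))"
proof -
  have "continuous_on UNIV (\<lambda>t. \<eta> t \<psi>)"
    if "\<And>t. ((\<lambda>s. \<eta> s \<psi>) has_vector_derivative \<eta>' t \<psi>) (at t)" for \<psi>
    using that by (intro continuous_at_imp_continuous_on) (auto intro: has_vector_derivative_continuous)
  then show ?thesis
    unfolding C1_weak_star_def continuous_map_weak_star limitin_weak_star
      has_vector_derivative_difference_quotient
    by (auto simp: tempered_difference_quotient)
qed

section \<open>The linearised operator on plane waves\<close>

text \<open>
  A real vector regarded as a complex one.
\<close>

definition cvec :: "real^3 \<Rightarrow> complex^3" where
  "cvec k = (\<chi> j. of_real (k $ j))"

text \<open>
  The field \<open>\<nabla> (a exp (2\<pi>ik\<cdot>x))\<close> at a fixed time; see \<open>gradient_wave\<close>.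
\<close>

definition wave_field :: "real \<Rightarrow> real^3 \<Rightarrow> cfield" where
  "wave_field a k = plane_wave k ((2 * of_real pi * \<i> * of_real a) *s cvec k)"

lemma cvec_nth [simp]: "cvec k $ j = of_real (k $ j)"
  by (simp add: cvec_def)

lemma plane_wave_eq: "plane_wave k v x = osc k x *s v"
  by (simp add: plane_wave_def osc_def)

lemma wave_field_nth:
  "wave_field a k x $ j = 2 * of_real pi * \<i> * of_real (a * k $ j) * osc k x"
  by (simp add: wave_field_def plane_wave_eq)

lemma osc_has_derivative:
  "(osc k has_derivative (\<lambda>h. 2 * of_real pi * \<i> * of_real (k \<bullet> h) * osc k x)) (at x)"
proof -
  have "((\<lambda>x. 2 * of_real pi * \<i> * of_real (k \<bullet> x)) has_derivative
      (\<lambda>h. 2 * complex_of_real pi * \<i> * of_real (k \<bullet> h))) (at x)"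
    by (intro has_derivative_mult_right has_derivative_of_real has_derivative_inner_right has_derivative_ident)
  from has_derivative_compose[OF this has_field_derivative_imp_has_derivative[OF DERIV_exp]]
  show ?thesis by (simp add: osc_def [abs_def] mult_ac)
qed

lemma gradient_wave:
  "gradient (\<lambda>y. of_real a * exp (2 * of_real pi * \<i> * of_real (k \<bullet> y))) = wave_field a k"
proof
  fix x
  have "((\<lambda>y. of_real a * osc k y) has_derivative
      (\<lambda>h. of_real a * (2 * of_real pi * \<i> * of_real (k \<bullet> h) * osc k x))) (at x)"
    by (intro has_derivative_mult_right osc_has_derivative)
  from frechet_derivative_at[OF this, symmetric]
  show "gradient (\<lambda>y. of_real a * exp (2 * of_real pi * \<i> * of_real (k \<bullet> y))) x = wave_field a k x"
    by (simp add: gradient_def vec_eq_iff wave_field_nth inner_axis osc_def)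
qed

lemma bounded_linear_vector_scalar_mult_left: "bounded_linear (\<lambda>z::complex. z *s (v::complex^3))"
  unfolding linear_conv_bounded_linear [symmetric]
  by (rule linearI) (simp_all add: vec_eq_iff algebra_simps)

lemma plane_wave_has_derivative:
  "(plane_wave k v has_derivative (\<lambda>h. (2 * of_real pi * \<i> * of_real (k \<bullet> h) * osc k x) *s v)) (at x)"
  unfolding plane_wave_eq [abs_def]
  by (rule bounded_linear.has_derivative[OF bounded_linear_vector_scalar_mult_left osc_has_derivative])

text \<open>
  The matrix \<open>- S\<^sup>T\<close> that drives the wave vector, \<open>S\<close> being the velocity matrix.
\<close>

definition wave_matrix :: "real^3^3 \<Rightarrow> real^3^3" where
  "wave_matrix A = - transpose (velocity_matrix A)"

lemma inner_velocity: "k \<bullet> steady_velocity A x = - ((wave_matrix A *v k) \<bullet> x)"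
proof -
  have "wave_matrix A *v k = - (k v* velocity_matrix A)"
    by (simp add: wave_matrix_def vec_eq_iff matrix_vector_mult_def vector_matrix_mult_def transpose_def
        sum_negf mult.commute)
  then show ?thesis
    by (simp add: steady_velocity_def dot_lmul_matrix)
qed

text \<open>
  For \<open>k = 0\<close> the field vanishes; written with another wave vector and amplitude zero, it is annihilated by the
  multiplier, so that the formula holds without exception.
\<close>

lemma lsg_operator_wave_field:
  "lsg_operator A (wave_field a k) x $ j
     = 2 * of_real pi * \<i> * of_real a * osc k x *
       (2 * of_real pi * \<i> * of_real (((wave_matrix A *v k) \<bullet> x) * k $ j)
         + of_real ((wave_matrix A *v k) $ j + symbol_m A k * k $ j))"
proof (cases "k = 0")
  case False
  define v where "v = (2 * of_real pi * \<i> * of_real a) *s cvec k"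
  have "frechet_derivative (plane_wave k v) (at x) (steady_velocity A x)
      = (2 * of_real pi * \<i> * of_real (k \<bullet> steady_velocity A x) * osc k x) *s v"
    by (simp add: frechet_derivative_at[OF plane_wave_has_derivative, symmetric])
  moreover have "(map_matrix of_real (transpose (velocity_matrix A)) *v plane_wave k v x) $ j
      = - (2 * of_real pi * \<i> * of_real a * osc k x * of_real ((wave_matrix A *v k) $ j))"
    by (simp add: wave_matrix_def matrix_vector_mult_def map_matrix_def plane_wave_eq v_def
        sum_distrib_left sum_negf mult_ac)
  ultimately show ?thesis
    by (simp add: lsg_operator_def wave_field_def v_def [symmetric] inner_velocity
        fourier_multiplier_plane_wave[OF False])
       (simp add: plane_wave_eq v_def algebra_simps)
next
  case True
  then have "wave_field a k = plane_wave (axis 1 1) 0"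
    by (simp add: fun_eq_iff wave_field_def plane_wave_eq vec_eq_iff)
  then show ?thesis
    by (simp add: lsg_operator_def fourier_multiplier_plane_wave frechet_derivative_at[OF plane_wave_has_derivative, symmetric] True)
       (simp add: plane_wave_eq)
qed

lemma continuous_on_componentwise_cart:
  fixes f :: "'a::topological_space \<Rightarrow> complex^3"
  assumes "\<And>j. continuous_on S (\<lambda>x. f x $ j)" shows "continuous_on S f"
proof -
  have "continuous_on S (\<lambda>x. \<chi> j. f x $ j)" by (intro continuous_intros assms)
  then show ?thesis by simp
qed

lemma norm_vector_le_3:
  fixes v :: "complex^3"
  assumes "\<And>j. norm (v $ j) \<le> C" shows "norm v \<le> 3 * C"
proof -
  have "norm v \<le> (\<Sum>j\<in>UNIV. norm (v $ j))" by (simp add: norm_vec_def L2_set_le_sum)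
  also have "\<dots> \<le> (\<Sum>j\<in>(UNIV::3 set). C)" by (intro sum_mono assms)
  finally show ?thesis by simp
qed

lemma continuous_wave_field: "continuous_on UNIV (wave_field a k)"
  by (intro continuous_on_componentwise_cart) (simp add: wave_field_nth, intro continuous_intros)

lemma continuous_lsg_wave_field: "continuous_on UNIV (lsg_operator A (wave_field a k))"
  by (intro continuous_on_componentwise_cart) (simp only: lsg_operator_wave_field, intro continuous_intros)

lemma wave_field_growth: "norm (wave_field a k x) \<le> (6 * pi * \<bar>a\<bar> * norm k) * (1 + norm x) ^ 0"
proof -
  have "norm (wave_field a k x $ j) \<le> 2 * pi * \<bar>a\<bar> * norm k" for j
    using mult_left_mono[OF component_le_norm_cart[of k j], of "2 * pi * \<bar>a\<bar>"]
    by (simp add: wave_field_nth norm_mult abs_mult mult.assoc)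
  from norm_vector_le_3[OF this] show ?thesis by simp
qed

text \<open>
  The transport term makes the image of a plane wave grow linearly in space, which a tempered distribution
  tolerates.
\<close>

lemma lsg_wave_field_growth:
  "\<exists>C. \<forall>x. norm (lsg_operator A (wave_field a k) x) \<le> C * (1 + norm x) ^ 1"
proof -
  define n where "n = wave_matrix A *v k"
  define D where "D = 2 * pi * norm n * norm k + norm n + \<bar>symbol_m A k\<bar> * norm k"
  have "norm (lsg_operator A (wave_field a k) x $ j) \<le> (2 * pi * \<bar>a\<bar>) * (D * (1 + norm x))" for x j
  proof -
    have D0: "0 \<le> D" by (simp add: D_def)
    have kj: "\<bar>k $ j\<bar> \<le> norm k" and nj: "\<bar>n $ j\<bar> \<le> norm n" by (rule component_le_norm_cart)+
    have nx: "\<bar>n \<bullet> x\<bar> \<le> norm n * norm x" by (rule Cauchy_Schwarz_ineq2)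
    have "norm (2 * of_real pi * \<i> * of_real ((n \<bullet> x) * k $ j) + of_real (n $ j + symbol_m A k * k $ j))
        \<le> 2 * pi * (\<bar>n \<bullet> x\<bar> * \<bar>k $ j\<bar>) + \<bar>n $ j + symbol_m A k * k $ j\<bar>"
      by (rule norm_triangle_le) (simp only: norm_mult norm_of_real abs_mult, simp add: abs_mult)
    also have "\<dots> \<le> 2 * pi * ((norm n * norm x) * norm k) + (norm n + \<bar>symbol_m A k\<bar> * norm k)"
    proof (intro add_mono mult_left_mono mult_mono nx kj)
      show "\<bar>n $ j + symbol_m A k * k $ j\<bar> \<le> norm n + \<bar>symbol_m A k\<bar> * norm k"
        using nj mult_left_mono[OF kj, of "\<bar>symbol_m A k\<bar>"] by (simp add: abs_mult [symmetric])
    qed auto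
    also have "\<dots> \<le> D * (1 + norm x)"
      by (simp add: D_def algebra_simps)
    finally show ?thesis
      unfolding lsg_operator_wave_field n_def [symmetric] norm_mult norm_osc
      by (simp add: mult_left_mono mult.assoc)
  qed
  from norm_vector_le_3[OF this] show ?thesis
    by (intro exI[of _ "3 * ((2 * pi * \<bar>a\<bar>) * D)"] allI) (simp add: mult.assoc)
qed

lemma tempered_wave_field: "regular_distribution (wave_field a k) \<in> tempered"
  by (rule regular_distribution_tempered[OF continuous_wave_field wave_field_growth])

lemma tempered_lsg_wave_field: "regular_distribution (lsg_operator A (wave_field a k)) \<in> tempered"
  using lsg_wave_field_growth regular_distribution_tempered[OF continuous_lsg_wave_field] by blast

lemma regular_distribution_wave_field:
  assumes \<psi>: "\<psi> \<in> schwartz"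
  shows "regular_distribution (wave_field a k) \<psi>
       = (\<Sum>j\<in>UNIV. 2 * of_real pi * \<i> * of_real (a * k $ j) * osc_integral (\<lambda>x. \<psi> x $ j) k)"
proof -
  have "regular_distribution (wave_field a k) \<psi>
      = (LINT x|lborel. (\<Sum>j\<in>UNIV. (2 * of_real pi * \<i> * of_real (a * k $ j)) * (osc k x * of_real (\<psi> x $ j))))"
    using \<psi> by (simp add: regular_distribution_def wave_field_nth mult.assoc)
  also have "\<dots> = (\<Sum>j\<in>UNIV. 2 * of_real pi * \<i> * of_real (a * k $ j) * osc_integral (\<lambda>x. \<psi> x $ j) k)"
    unfolding osc_integral_def
    by (subst Bochner_Integration.integral_sum)
       (intro integrable_mult_right integrable_osc schwartz_all_moments \<psi>, simp only: integral_mult_right_zero)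
  finally show ?thesis .
qed

lemma regular_distribution_lsg_wave_field:
  assumes \<psi>: "\<psi> \<in> schwartz"
  shows "regular_distribution (lsg_operator A (wave_field a k)) \<psi>
       = (\<Sum>j\<in>UNIV. 2 * of_real pi * \<i> * of_real a *
           (of_real (k $ j) * (2 * of_real pi * \<i> * osc_integral (\<lambda>x. ((wave_matrix A *v k) \<bullet> x) * \<psi> x $ j) k)
             + of_real ((wave_matrix A *v k) $ j + symbol_m A k * k $ j) * osc_integral (\<lambda>x. \<psi> x $ j) k))"
proof -
  define n where "n = wave_matrix A *v k"
  define c where "c = 2 * complex_of_real pi * \<i> * of_real a"
  define b where "b j = complex_of_real (n $ j + symbol_m A k * k $ j)" for j
  have i1: "integrable lborel (\<lambda>x. osc k x * of_real (\<psi> x $ j))" for j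
    by (intro integrable_osc schwartz_all_moments \<psi>)
  have i2: "integrable lborel (\<lambda>x. osc k x * of_real ((n \<bullet> x) * \<psi> x $ j))" for j
    by (intro integrable_osc all_moments_inner_mult schwartz_all_moments \<psi>)
  have "regular_distribution (lsg_operator A (wave_field a k)) \<psi>
      = (LINT x|lborel. (\<Sum>j\<in>UNIV. c * (of_real (k $ j) * (2 * of_real pi * \<i> * (osc k x * of_real ((n \<bullet> x) * \<psi> x $ j)))
             + b j * (osc k x * of_real (\<psi> x $ j)))))"
    using \<psi> by (simp add: regular_distribution_def lsg_operator_wave_field n_def c_def b_def)
       (simp add: algebra_simps)
  also have "\<dots> = (\<Sum>j\<in>UNIV. c * (of_real (k $ j) * (2 * of_real pi * \<i> * osc_integral (\<lambda>x. (n \<bullet> x) * \<psi> x $ j) k)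
             + b j * osc_integral (\<lambda>x. \<psi> x $ j) k))"
    unfolding osc_integral_def
    by (subst Bochner_Integration.integral_sum)
       (intro integrable_mult_right Bochner_Integration.integrable_add i1 i2,
        simp only: integral_mult_right_zero Bochner_Integration.integral_add[OF integrable_mult_right integrable_mult_right[OF i1]]
          integrable_mult_right[OF i2])
  finally show ?thesis by (simp only: n_def c_def b_def)
qed

lemma osc_integral_chain:
  assumes p: "all_moments p" and k: "(k has_vector_derivative k') (at t)"
  shows "((\<lambda>s. osc_integral p (k s)) has_vector_derivative
           2 * of_real pi * \<i> * osc_integral (\<lambda>x. (k' \<bullet> x) * p x) (k t)) (at t)"
proof -
  interpret bounded_linear "\<lambda>h. 2 * of_real pi * \<i> * osc_integral (\<lambda>x. (h \<bullet> x) * p x) (k t)"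
    by (rule has_derivative_bounded_linear[OF osc_integral_has_derivative[OF p]])
  show ?thesis
    using has_derivative_compose[OF k[unfolded has_vector_derivative_def] osc_integral_has_derivative[OF p]]
    by (simp only: has_vector_derivative_def scaleR)
qed

text \<open>
  Any solution of the two ordinary differential equations yields a strong solution.  Continuity of
  \<open>m\<close> along the wave vector has to be asked for, as \<open>m\<close> need not be continuous at the origin.
\<close>

lemma plane_wave_solution_of_ode:
  assumes k: "\<And>t. (k has_vector_derivative wave_matrix A *v k t) (at t)"
    and a: "\<And>t. (a has_real_derivative symbol_m A (k t) * a t) (at t)"
    and m: "continuous_on UNIV (\<lambda>t. symbol_m A (k t))"
  shows "plane_wave_solution A (\<lambda>x t. wave_field (a t) (k t) x)"
proof -
  define n where "n t = wave_matrix A *v k t" for t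
  have kc: "continuous_on UNIV k"
    using k by (intro continuous_at_imp_continuous_on) (auto intro: has_vector_derivative_continuous)
  have ac: "continuous_on UNIV a"
    using a by (intro continuous_at_imp_continuous_on) (auto intro: DERIV_isCont)
  have nc: "continuous_on UNIV n"
    unfolding n_def by (rule bounded_linear.continuous_on[OF matrix_vector_mul_bounded_linear kc])
  have kj: "((\<lambda>s. k s $ j) has_real_derivative n t $ j) (at t)" for j t
    using bounded_linear.has_vector_derivative[OF bounded_linear_vec_nth k]
    by (simp add: n_def has_real_derivative_iff_has_vector_derivative)
  have aj: "((\<lambda>s. 2 * of_real pi * \<i> * of_real (a s * k s $ j)) has_vector_derivative
      2 * of_real pi * \<i> * of_real (a t * (n t $ j + symbol_m A (k t) * k t $ j))) (at t)" for j t
  proof -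
    have "((\<lambda>s. a s * k s $ j) has_real_derivative a t * (n t $ j + symbol_m A (k t) * k t $ j)) (at t)"
      by (rule DERIV_cong[OF DERIV_mult[OF a kj]]) (simp add: algebra_simps)
    then show ?thesis
      by (intro has_vector_derivative_mult_right has_vector_derivative_of_real)
         (simp add: has_real_derivative_iff_has_vector_derivative)
  qed
  have "C1_weak_star (\<lambda>t. regular_distribution (wave_field (a t) (k t)))
          (\<lambda>t. regular_distribution (lsg_operator A (wave_field (a t) (k t))))"
    unfolding C1_weak_star_iff
  proof (intro conjI ballI allI tempered_wave_field tempered_lsg_wave_field)
    fix \<psi> :: "real^3 \<Rightarrow> real^3" and t assume \<psi>: "\<psi> \<in> schwartz"
    have mom: "all_moments (\<lambda>x. \<psi> x $ j)" for j by (rule schwartz_all_moments[OF \<psi>])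
    have "((\<lambda>s. \<Sum>j\<in>UNIV. 2 * of_real pi * \<i> * of_real (a s * k s $ j) * osc_integral (\<lambda>x. \<psi> x $ j) (k s))
      has_vector_derivative
        (\<Sum>j\<in>UNIV. 2 * of_real pi * \<i> * of_real (a t * k t $ j) * (2 * of_real pi * \<i> * osc_integral (\<lambda>x. (n t \<bullet> x) * \<psi> x $ j) (k t))
         + 2 * of_real pi * \<i> * of_real (a t * (n t $ j + symbol_m A (k t) * k t $ j)) * osc_integral (\<lambda>x. \<psi> x $ j) (k t)))
      (at t)"
      by (intro has_vector_derivative_sum has_vector_derivative_mult aj osc_integral_chain[OF mom k[folded n_def]])
    then show "((\<lambda>s. regular_distribution (wave_field (a s) (k s)) \<psi>) has_vector_derivative
        regular_distribution (lsg_operator A (wave_field (a t) (k t))) \<psi>) (at t)"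
      unfolding regular_distribution_wave_field[OF \<psi>] regular_distribution_lsg_wave_field[OF \<psi>] n_def [symmetric]
      by (rule back_subst[of "\<lambda>d. (_ has_vector_derivative d) _"])
         (intro sum.cong refl, simp add: algebra_simps)
  next
    fix \<psi> :: "real^3 \<Rightarrow> real^3" assume \<psi>: "\<psi> \<in> schwartz"
    have mom: "all_moments (\<lambda>x. \<psi> x $ j)" for j by (rule schwartz_all_moments[OF \<psi>])
    have "continuous_on UNIV (\<lambda>t. osc_integral (\<lambda>x. (n t \<bullet> x) * \<psi> x $ j) (k t))" for j
      by (subst osc_integral_inner_expand[OF mom])
        (intro continuous_intros nc continuous_osc_integral all_moments_inner_mult mom kc)
    then show "continuous_on UNIV (\<lambda>t. regular_distribution (lsg_operator A (wave_field (a t) (k t))) \<psi>)"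
      unfolding regular_distribution_lsg_wave_field[OF \<psi>] n_def [symmetric]
      by (intro continuous_intros ac kc nc m continuous_osc_integral mom)
  qed
  then have "strong_solution A (\<lambda>x t. wave_field (a t) (k t) x)"
    unfolding strong_solution_def by (intro exI conjI) auto
  then show ?thesis
    unfolding plane_wave_solution_def gradient_wave by blast
qed

section \<open>From the weak equation to ordinary differential equations\<close>

text \<open>
  The Fourier transform of the Gaussian on three-dimensional space; see \<open>osc_gaussian\<close>.
\<close>

definition gaussian_hat :: "real^3 \<Rightarrow> real" where
  "gaussian_hat k = sqrt (2 * pi) ^ 3 * exp (- 2 * pi\<^sup>2 * (k \<bullet> k))"

lemma gaussian_hat_pos: "0 < gaussian_hat k"
  by (simp add: gaussian_hat_def)

lemma gaussian_hat_has_derivative: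
  "(gaussian_hat has_derivative (\<lambda>h. - 4 * pi\<^sup>2 * (k \<bullet> h) * gaussian_hat k)) (at k)"
  unfolding gaussian_hat_def [abs_def]
  by (auto intro!: derivative_eq_intros simp: inner_commute algebra_simps)

lemma continuous_gaussian_hat [continuous_intros]:
  "continuous_on S f \<Longrightarrow> continuous_on S (\<lambda>s. gaussian_hat (f s))"
  unfolding gaussian_hat_def by (intro continuous_intros)

lemma all_moments_gaussian: "all_moments (gaussian :: real^3 \<Rightarrow> real)"
  using schwartz_all_moments[OF schwartz_polynomial_gaussian[OF real_polynomial_function.intros(2)[of 1]],
      of "axis 1 1" 1] by simp

lemma osc_gaussian: "osc_integral gaussian k = of_real (gaussian_hat k)"
  by (simp add: osc_integral_gaussian gaussian_hat_def)

text \<open>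
  The moments of the Gaussian against a plane wave are read off from the derivative of the transform, computed once
  under the integral and once from the explicit formula.
\<close>

lemma osc_first_moment_gaussian:
  "osc_integral (\<lambda>x. (h \<bullet> x) * gaussian x) k = 2 * of_real pi * \<i> * of_real ((k \<bullet> h) * gaussian_hat k)"
proof -
  have "(osc_integral gaussian has_derivative (\<lambda>h. of_real (- 4 * pi\<^sup>2 * (k \<bullet> h) * gaussian_hat k))) (at k)"
    unfolding osc_gaussian [abs_def] by (intro has_derivative_of_real gaussian_hat_has_derivative)
  from has_derivative_unique[OF osc_integral_has_derivative[OF all_moments_gaussian] this]
  have "2 * of_real pi * \<i> * osc_integral (\<lambda>x. (h \<bullet> x) * gaussian x) k
      = of_real (- 4 * pi\<^sup>2 * (k \<bullet> h) * gaussian_hat k)" by (rule fun_cong)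
  also have "\<dots> = 2 * of_real pi * \<i> * (2 * of_real pi * \<i> * of_real ((k \<bullet> h) * gaussian_hat k))"
    by (simp add: power2_eq_square)
  finally show ?thesis by simp
qed

lemma osc_second_moment_gaussian:
  "osc_integral (\<lambda>x. (h' \<bullet> x) * ((h \<bullet> x) * gaussian x)) k
     = of_real ((h \<bullet> h' - 4 * pi\<^sup>2 * (k \<bullet> h) * (k \<bullet> h')) * gaussian_hat k)"
proof -
  have "((\<lambda>k. (k \<bullet> h) * gaussian_hat k) has_derivative
      (\<lambda>h'. (k \<bullet> h) * (- 4 * pi\<^sup>2 * (k \<bullet> h') * gaussian_hat k) + (h' \<bullet> h) * gaussian_hat k)) (at k)"
    by (intro has_derivative_mult gaussian_hat_has_derivative has_derivative_inner_left has_derivative_ident)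
  then have "(osc_integral (\<lambda>x. (h \<bullet> x) * gaussian x) has_derivative
      (\<lambda>h'. 2 * of_real pi * \<i> * of_real ((k \<bullet> h) * (- 4 * pi\<^sup>2 * (k \<bullet> h') * gaussian_hat k) + (h' \<bullet> h) * gaussian_hat k))) (at k)"
    unfolding osc_first_moment_gaussian [abs_def] by (intro has_derivative_mult_right has_derivative_of_real)
  from fun_cong[OF has_derivative_unique[OF osc_integral_has_derivative[OF all_moments_inner_mult[OF all_moments_gaussian]] this], of h']
  have "2 * of_real pi * \<i> * osc_integral (\<lambda>x. (h' \<bullet> x) * ((h \<bullet> x) * gaussian x)) k
      = 2 * of_real pi * \<i> * of_real ((h \<bullet> h' - 4 * pi\<^sup>2 * (k \<bullet> h) * (k \<bullet> h')) * gaussian_hat k)"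
    by (simp add: inner_commute algebra_simps)
  then show ?thesis by simp
qed

text \<open>
  Test functions with a single nonzero component pick out a single component of the wave.
\<close>

lemma regular_distribution_test:
  assumes "(\<lambda>x. q x *\<^sub>R axis j 1) \<in> schwartz"
  shows "regular_distribution (wave_field a k) (\<lambda>x. q x *\<^sub>R axis j 1)
       = 2 * of_real pi * \<i> * of_real (a * k $ j) * osc_integral q k"
    and "regular_distribution (lsg_operator A (wave_field a k)) (\<lambda>x. q x *\<^sub>R axis j 1)
       = 2 * of_real pi * \<i> * of_real a *
           (of_real (k $ j) * (2 * of_real pi * \<i> * osc_integral (\<lambda>x. ((wave_matrix A *v k) \<bullet> x) * q x) k)
             + of_real ((wave_matrix A *v k) $ j + symbol_m A k * k $ j) * osc_integral q k)"
proof -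
  have 0: "osc_integral (\<lambda>x. 0) k = 0" by (simp add: osc_integral_def)
  have eq: "(\<lambda>x. (q x *\<^sub>R axis j 1 :: real^3) $ i) = (if i = j then q else (\<lambda>x. 0))" for i
    by (auto simp: axis_def)
  have eq': "(\<lambda>x. ((wave_matrix A *v k) \<bullet> x) * (q x *\<^sub>R axis j 1 :: real^3) $ i)
      = (if i = j then (\<lambda>x. ((wave_matrix A *v k) \<bullet> x) * q x) else (\<lambda>x. 0))" for i
    by (auto simp: axis_def)
  have s: "(\<Sum>i\<in>UNIV. f i) = f j" if "\<And>i. i \<noteq> j \<Longrightarrow> f i = 0" for f :: "3 \<Rightarrow> complex"
    using sum.remove[of UNIV j f] that by simp
  show "regular_distribution (wave_field a k) (\<lambda>x. q x *\<^sub>R axis j 1)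
       = 2 * of_real pi * \<i> * of_real (a * k $ j) * osc_integral q k"
    unfolding regular_distribution_wave_field[OF assms] eq by (subst s) (simp_all add: 0)
  show "regular_distribution (lsg_operator A (wave_field a k)) (\<lambda>x. q x *\<^sub>R axis j 1)
       = 2 * of_real pi * \<i> * of_real a *
           (of_real (k $ j) * (2 * of_real pi * \<i> * osc_integral (\<lambda>x. ((wave_matrix A *v k) \<bullet> x) * q x) k)
             + of_real ((wave_matrix A *v k) $ j + symbol_m A k * k $ j) * osc_integral q k)"
    unfolding regular_distribution_lsg_wave_field[OF assms] eq eq' by (subst s) (simp_all add: 0)
qed

lemma has_real_derivative_of_complex_multiple:
  assumes "((\<lambda>s. c * complex_of_real (r s)) has_vector_derivative c * of_real r') (at t)" "c \<noteq> 0"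
  shows "(r has_real_derivative r') (at t)"
proof -
  have "((\<lambda>s. inverse c * (c * complex_of_real (r s))) has_vector_derivative inverse c * (c * of_real r')) (at t)"
    by (rule has_vector_derivative_mult_right[OF assms(1)])
  then have "((\<lambda>s. complex_of_real (r s)) has_vector_derivative of_real r') (at t)"
    using assms(2) by (simp add: mult.assoc [symmetric])
  from bounded_linear.has_vector_derivative[OF bounded_linear_Re this]
  show ?thesis by (simp add: has_real_derivative_iff_has_vector_derivative)
qed

text \<open>
  A strong solution of plane-wave form.  Nothing is assumed about the regularity of the amplitude and the wave
  vector.
\<close>

locale weak_plane_wave =
  fixes A :: "real^3^3" and a :: "real \<Rightarrow> real" and k :: "real \<Rightarrow> real^3"
  assumes weak: "strong_solution A (\<lambda>x t. wave_field (a t) (k t) x)"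
begin

lemma weak_derivative:
  assumes "\<psi> \<in> schwartz"
  shows "((\<lambda>s. regular_distribution (wave_field (a s) (k s)) \<psi>) has_vector_derivative
           regular_distribution (lsg_operator A (wave_field (a t) (k t))) \<psi>) (at t)"
proof -
  obtain \<eta>' where *: "C1_weak_star (\<lambda>t. regular_distribution (wave_field (a t) (k t))) \<eta>'"
    "\<And>t. \<eta>' t = regular_distribution (lsg_operator A (wave_field (a t) (k t)))"
    using weak unfolding strong_solution_def by auto
  then show ?thesis using assms unfolding C1_weak_star_iff by metis
qed

text \<open>
  The rate at which the multiplier and the change of the Gaussian weight along \<open>k\<close> together make the
  moments grow; it is common to all of them and cancels in their quotients.
\<close>

definition growth :: "real \<Rightarrow> real" where
  "growth t = symbol_m A (k t) - 4 * pi\<^sup>2 * (k t \<bullet> (wave_matrix A *v k t))"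

text \<open>
  Up to a constant factor, the pairing of the wave with the Gaussian in the component \<open>j\<close> and, in
  \<open>moment1\<close>, with the coordinate \<open>l\<close> times that Gaussian.  The quotient of the second by the first is \<open>k\<^sub>l\<close>.
\<close>

definition moment0 :: "3 \<Rightarrow> real \<Rightarrow> real" where
  "moment0 j t = a t * k t $ j * gaussian_hat (k t)"

definition moment1 :: "3 \<Rightarrow> 3 \<Rightarrow> real \<Rightarrow> real" where
  "moment1 l j t = k t $ l * moment0 j t"

lemma moment0_derivative:
  "(moment0 j has_real_derivative
      a t * ((wave_matrix A *v k t) $ j + growth t * k t $ j) * gaussian_hat (k t)) (at t)"
proof (rule has_real_derivative_of_complex_multiple[where c = "2 * of_real pi * \<i>"])
  have S: "(\<lambda>x. gaussian x *\<^sub>R axis j 1) \<in> schwartz"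
    using schwartz_polynomial_gaussian[OF real_polynomial_function.intros(2)[of 1]] by simp
  show "((\<lambda>s. 2 * of_real pi * \<i> * complex_of_real (moment0 j s)) has_vector_derivative
      2 * of_real pi * \<i> * of_real (a t * ((wave_matrix A *v k t) $ j + growth t * k t $ j) * gaussian_hat (k t))) (at t)"
    using weak_derivative[OF S, of t]
    unfolding regular_distribution_test[OF S] osc_gaussian osc_first_moment_gaussian
    by (simp add: moment0_def growth_def algebra_simps power2_eq_square)
qed simp

lemma moment1_derivative:
  "(moment1 l j has_real_derivative
      (wave_matrix A *v k t) $ l * moment0 j t
      + k t $ l * (a t * ((wave_matrix A *v k t) $ j + growth t * k t $ j) * gaussian_hat (k t))) (at t)"
proof (rule has_real_derivative_of_complex_multiple[where c = "2 * of_real pi * \<i> * (2 * of_real pi * \<i>)"])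
  have S: "(\<lambda>x. ((axis l 1 \<bullet> x) * gaussian x) *\<^sub>R axis j 1) \<in> schwartz"
    by (intro schwartz_polynomial_gaussian real_polynomial_function.intros(1) bounded_linear_inner_right)
  show "((\<lambda>s. 2 * of_real pi * \<i> * (2 * of_real pi * \<i>) * complex_of_real (moment1 l j s)) has_vector_derivative
      2 * of_real pi * \<i> * (2 * of_real pi * \<i>) * of_real ((wave_matrix A *v k t) $ l * moment0 j t
      + k t $ l * (a t * ((wave_matrix A *v k t) $ j + growth t * k t $ j) * gaussian_hat (k t)))) (at t)"
    using weak_derivative[OF S, of t]
    unfolding regular_distribution_test[OF S] osc_first_moment_gaussian osc_second_moment_gaussian
    by (simp add: moment0_def moment1_def growth_def inner_axis inner_axis' algebra_simps power2_eq_square)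
qed simp

text \<open>
  The times at which the wave does not vanish.
\<close>

definition support :: "real set" where
  "support = {t. a t \<noteq> 0 \<and> k t \<noteq> 0}"

lemma support_iff: "t \<in> support \<longleftrightarrow> (\<exists>j. moment0 j t \<noteq> 0)"
  using gaussian_hat_pos[of "k t"] by (auto simp: support_def moment0_def vec_eq_iff)

lemma continuous_moment0: "continuous_on UNIV (moment0 j)"
  using moment0_derivative by (intro continuous_at_imp_continuous_on) (auto intro: DERIV_isCont)

lemma eventually_moment0:
  assumes "moment0 j t \<noteq> 0" shows "\<forall>\<^sub>F s in nhds t. moment0 j s \<noteq> 0"
proof -
  have "open (moment0 j -` (- {0}))" by (intro open_vimage continuous_moment0) auto
  with assms show ?thesis by (auto simp: eventually_nhds)
qed

lemma open_support: "open support"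
proof -
  have "support = (\<Union>j. moment0 j -` (- {0}))" by (auto simp: support_iff)
  then show ?thesis by (auto intro!: open_vimage continuous_moment0)
qed

lemma wave_vector_derivative_component:
  assumes "t \<in> support"
  shows "((\<lambda>s. k s $ l) has_real_derivative (wave_matrix A *v k t) $ l) (at t)"
proof -
  obtain j where j: "moment0 j t \<noteq> 0" using assms by (auto simp: support_iff)
  have "((\<lambda>s. moment1 l j s / moment0 j s) has_real_derivative (wave_matrix A *v k t) $ l) (at t)"
    by (rule DERIV_cong[OF DERIV_divide[OF moment1_derivative moment0_derivative j]])
       (use j in \<open>simp add: field_simps moment1_def\<close>)
  moreover have "\<forall>\<^sub>F s in nhds t. k s $ l = moment1 l j s / moment0 j s"
    by (rule eventually_mono[OF eventually_moment0[OF j]]) (simp add: moment1_def)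
  ultimately show ?thesis by (simp add: DERIV_cong_ev[OF refl _ refl])
qed

lemma wave_vector_ode:
  assumes "t \<in> support"
  shows "(k has_vector_derivative wave_matrix A *v k t) (at t)"
  unfolding has_vector_derivative_def
proof (subst has_derivative_componentwise_within, intro ballI)
  fix b :: "real^3" assume "b \<in> Basis"
  then obtain l where l: "b = axis l 1" by (auto simp: Basis_vec_def)
  show "((\<lambda>s. k s \<bullet> b) has_derivative (\<lambda>h. (h *\<^sub>R (wave_matrix A *v k t)) \<bullet> b)) (at t)"
    using wave_vector_derivative_component[OF assms, of l]
    by (simp add: l inner_axis has_field_derivative_def mult_commute_abs)
qed

lemma amplitude_ode:
  assumes "t \<in> support"
  shows "(a has_real_derivative symbol_m A (k t) * a t) (at t)"
proof -
  obtain j where j: "moment0 j t \<noteq> 0" using assms by (auto simp: support_iff)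
  then have kj: "k t $ j \<noteq> 0" and G: "gaussian_hat (k t) \<noteq> 0" by (auto simp: moment0_def)
  have dG: "((\<lambda>s. gaussian_hat (k s)) has_real_derivative
      - 4 * pi\<^sup>2 * (k t \<bullet> (wave_matrix A *v k t)) * gaussian_hat (k t)) (at t)"
    using has_derivative_compose[OF wave_vector_ode[OF assms, unfolded has_vector_derivative_def]
        gaussian_hat_has_derivative]
    unfolding has_field_derivative_def by (rule has_derivative_eq_rhs) (simp add: fun_eq_iff mult_ac)
  have "((\<lambda>s. moment0 j s / (k s $ j * gaussian_hat (k s))) has_real_derivative symbol_m A (k t) * a t) (at t)"
    by (rule DERIV_cong[OF DERIV_divide[OF moment0_derivative
            DERIV_mult[OF wave_vector_derivative_component[OF assms] dG]]])
       (use kj G in \<open>simp_all add: field_simps moment0_def growth_def\<close>)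
  moreover have "\<forall>\<^sub>F s in nhds t. a s = moment0 j s / (k s $ j * gaussian_hat (k s))"
    by (rule eventually_mono[OF eventually_moment0[OF j]]) (simp add: moment0_def)
  ultimately show ?thesis by (simp add: DERIV_cong_ev[OF refl _ refl])
qed

end

section \<open>The linear algebra of a steady state\<close>

lemma J_mult: "J *v y = vector [- y $ 2, y $ 1, 0]"
  by (simp add: J_def vec_eq_iff forall_3 matrix_vector_mult_def sum_3)

lemma inner_J: "x \<bullet> (J *v y) = - ((J *v x) \<bullet> y)"
  by (simp add: J_mult inner_vec_def sum_3)

lemma transpose_J: "transpose J = - J"
  by (simp add: J_def vec_eq_iff forall_3 transpose_def)

text \<open>
  The setting of a quadratic steady state with matrix \<open>A\<close>.  The system for \<open>y = A\<^sup>-\<^sup>1 k\<close> is \<open>y' = B J y\<close>, where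
  \<open>B = I - A\<^sup>-\<^sup>1\<close>, and \<open>q\<close> is the upper left minor of order two of \<open>B\<close>.
\<close>

locale steady_state =
  fixes A :: "real^3^3"
  assumes symmetric: "transpose A = A" and pos_def: "positive_definite A"
begin

abbreviation Ainv :: "real^3^3" where "Ainv \<equiv> matrix_inv A"

definition B :: "real^3^3" where "B = mat 1 - Ainv"

definition q :: real where "q = B $ 1 $ 1 * B $ 2 $ 2 - (B $ 1 $ 2)\<^sup>2"

lemma quadratic_pos: "x \<noteq> 0 \<Longrightarrow> 0 < x \<bullet> (A *v x)"
  using pos_def by (simp add: positive_definite_def)

lemma invertible_A: "invertible A"
  unfolding invertible_left_inverse matrix_left_invertible_ker
proof (intro allI impI)
  fix x assume "A *v x = 0"
  then show "x = 0" using quadratic_pos[of x] by (cases "x = 0") auto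
qed

lemma inv_mult [simp]: "Ainv ** A = mat 1" "A ** Ainv = mat 1"
  using someI_ex[OF invertible_A[unfolded invertible_def]] by (simp_all add: matrix_inv_def)

lemma inv_mult_vec [simp]: "Ainv *v (A *v x) = x" "A *v (Ainv *v x) = x"
  by (simp_all add: matrix_vector_mul_assoc)

lemma transpose_inv: "transpose Ainv = Ainv"
proof -
  have "A ** transpose Ainv = mat 1"
    using arg_cong[OF inv_mult(1), of transpose]
    unfolding matrix_transpose_mul symmetric transpose_mat .
  then have "Ainv ** A ** transpose Ainv = Ainv"
    unfolding matrix_mul_assoc [symmetric] by simp
  then show ?thesis by simp
qed

lemma inner_A: "x \<bullet> (A *v y) = (A *v x) \<bullet> y"
  using dot_lmul_matrix[of x A y] transpose_matrix_vector[of A x] symmetric by simp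

lemma inner_Ainv: "x \<bullet> (Ainv *v y) = (Ainv *v x) \<bullet> y"
  using dot_lmul_matrix[of x Ainv y] transpose_matrix_vector[of Ainv x] transpose_inv by simp

lemma A_entries: "A $ 2 $ 1 = A $ 1 $ 2" "A $ 3 $ 1 = A $ 1 $ 3" "A $ 3 $ 2 = A $ 2 $ 3"
proof -
  have s: "A $ j $ i = A $ i $ j" for i j
    using arg_cong[OF symmetric, of "\<lambda>M. M $ i $ j"] by (simp add: transpose_def)
  show "A $ 2 $ 1 = A $ 1 $ 2" "A $ 3 $ 1 = A $ 1 $ 3" "A $ 3 $ 2 = A $ 2 $ 3" by (rule s)+
qed

lemma B_entries: "B $ 2 $ 1 = B $ 1 $ 2" "B $ 3 $ 1 = B $ 1 $ 3" "B $ 3 $ 2 = B $ 2 $ 3"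
proof -
  have s: "B $ j $ i = B $ i $ j" for i j
    using arg_cong[OF transpose_inv, of "\<lambda>M. M $ i $ j"] by (simp add: B_def transpose_def mat_def)
  show "B $ 2 $ 1 = B $ 1 $ 2" "B $ 3 $ 1 = B $ 1 $ 3" "B $ 3 $ 2 = B $ 2 $ 3" by (rule s)+
qed

text \<open>
  Evaluation of the quadratic form at the last column of the adjugate gives \<open>det A\<close> times the leading minor of
  order two, and that minor is treated in the same way.
\<close>

lemma det_A_pos: "0 < det A"
proof -
  define x :: "real^3" where "x = vector [- A $ 1 $ 2, A $ 1 $ 1, 0]"
  define z :: "real^3" where "z = vector [A $ 1 $ 2 * A $ 2 $ 3 - A $ 1 $ 3 * A $ 2 $ 2,
     A $ 1 $ 2 * A $ 1 $ 3 - A $ 1 $ 1 * A $ 2 $ 3, A $ 1 $ 1 * A $ 2 $ 2 - (A $ 1 $ 2)\<^sup>2]"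
  have 1: "0 < A $ 1 $ 1"
    using quadratic_pos[of "axis 1 1"] by (simp add: inner_axis' matrix_vector_mul_component axis_eq_0_iff inner_axis)
  then have "x \<noteq> 0" by (auto simp: x_def vec_eq_iff forall_3)
  then have "0 < A $ 1 $ 1 * (A $ 1 $ 1 * A $ 2 $ 2 - (A $ 1 $ 2)\<^sup>2)"
    using quadratic_pos[of x]
    by (simp add: x_def inner_vec_def sum_3 matrix_vector_mult_def A_entries algebra_simps power2_eq_square)
  then have 2: "0 < A $ 1 $ 1 * A $ 2 $ 2 - (A $ 1 $ 2)\<^sup>2"
    using 1 by (simp add: zero_less_mult_iff)
  then have "z \<noteq> 0" by (auto simp: z_def vec_eq_iff forall_3)
  then have "0 < z \<bullet> (A *v z)" by (rule quadratic_pos)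
  also have "z \<bullet> (A *v z) = det A * (A $ 1 $ 1 * A $ 2 $ 2 - (A $ 1 $ 2)\<^sup>2)"
    by (simp add: z_def inner_vec_def sum_3 matrix_vector_mult_def A_entries det_3 algebra_simps power2_eq_square)
  finally show ?thesis using 2 by (simp add: zero_less_mult_iff)
qed

text \<open>
  The entries needed of the adjugate formula for the inverse.
\<close>

lemma det_mult_inv_entries:
  "det A * Ainv $ 1 $ 1 = A $ 2 $ 2 * A $ 3 $ 3 - (A $ 2 $ 3)\<^sup>2"
  "det A * Ainv $ 1 $ 2 = A $ 1 $ 3 * A $ 2 $ 3 - A $ 1 $ 2 * A $ 3 $ 3"
  "det A * Ainv $ 2 $ 2 = A $ 1 $ 1 * A $ 3 $ 3 - (A $ 1 $ 3)\<^sup>2"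
proof -
  define C :: "real^3^3" where "C = vector
    [vector [A $ 2 $ 2 * A $ 3 $ 3 - (A $ 2 $ 3)\<^sup>2, A $ 1 $ 3 * A $ 2 $ 3 - A $ 1 $ 2 * A $ 3 $ 3,
        A $ 1 $ 2 * A $ 2 $ 3 - A $ 1 $ 3 * A $ 2 $ 2],
     vector [A $ 1 $ 3 * A $ 2 $ 3 - A $ 1 $ 2 * A $ 3 $ 3, A $ 1 $ 1 * A $ 3 $ 3 - (A $ 1 $ 3)\<^sup>2,
        A $ 1 $ 2 * A $ 1 $ 3 - A $ 1 $ 1 * A $ 2 $ 3],
     vector [A $ 1 $ 2 * A $ 2 $ 3 - A $ 1 $ 3 * A $ 2 $ 2, A $ 1 $ 2 * A $ 1 $ 3 - A $ 1 $ 1 * A $ 2 $ 3,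
        A $ 1 $ 1 * A $ 2 $ 2 - (A $ 1 $ 2)\<^sup>2]]"
  have "C ** A = det A *\<^sub>R mat 1"
    by (simp add: C_def vec_eq_iff forall_3 matrix_matrix_mult_def sum_3 A_entries det_3 mat_def
        algebra_simps power2_eq_square)
  then have "(C ** A) ** Ainv = det A *\<^sub>R Ainv" by (simp add: scalar_matrix_assoc [symmetric])
  then have "C = det A *\<^sub>R Ainv" by (simp add: matrix_mul_assoc [symmetric])
  then have "C $ i $ j = det A * Ainv $ i $ j" for i j by simp
  from this[of 1 1] this[of 1 2] this[of 2 2] show
    "det A * Ainv $ 1 $ 1 = A $ 2 $ 2 * A $ 3 $ 3 - (A $ 2 $ 3)\<^sup>2"
    "det A * Ainv $ 1 $ 2 = A $ 1 $ 3 * A $ 2 $ 3 - A $ 1 $ 2 * A $ 3 $ 3"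
    "det A * Ainv $ 2 $ 2 = A $ 1 $ 1 * A $ 3 $ 3 - (A $ 1 $ 3)\<^sup>2"
    by (simp_all add: C_def)
qed

text \<open>
  The sign of \<open>mu A\<close> decides the type of the planar part of \<open>y' = B J y\<close>.
\<close>

lemma q_det: "q * det A = - mu A"
proof -
  let ?D = "det A"
  have "?D * (q * ?D) = (?D - ?D * Ainv $ 1 $ 1) * (?D - ?D * Ainv $ 2 $ 2) - (?D * Ainv $ 1 $ 2)\<^sup>2"
    by (simp add: q_def B_def mat_def algebra_simps power2_eq_square)
  also have "\<dots> = ?D * (- mu A)"
    unfolding det_mult_inv_entries
    by (simp add: mu_def Let_def det_3 A_entries algebra_simps power2_eq_square)
  finally show ?thesis using det_A_pos by (metis less_irrefl mult_cancel_left)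
qed

lemma q_pos: "mu A < 0 \<Longrightarrow> 0 < q"
  using q_det det_A_pos by (metis neg_0_less_iff_less zero_less_mult_pos2)

lemma q_neg: "0 < mu A \<Longrightarrow> q < 0"
  using q_det det_A_pos by (metis mult_neg_pos neg_less_0_iff_less not_less_iff_gr_or_eq mult_pos_pos mult_zero_left)

lemma wave_matrix_mult: "wave_matrix A *v k = (A - mat 1) *v (J *v (Ainv *v k))"
proof -
  have "transpose (A - mat 1) = A - mat 1"
    using arg_cong[OF symmetric, of "\<lambda>M. M - mat 1"] by (simp add: vec_eq_iff transpose_def mat_def)
  then have "wave_matrix A = - ((A - mat 1) ** (- J ** Ainv))"
    by (simp add: wave_matrix_def velocity_matrix_def matrix_transpose_mul transpose_J transpose_inv)
  also have "\<dots> = (A - mat 1) ** (J ** Ainv)"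
    by (simp add: vec_eq_iff matrix_matrix_mult_def sum_negf)
  finally show ?thesis by (simp add: matrix_vector_mul_assoc)
qed

lemma inv_wave_matrix_mult: "Ainv *v (wave_matrix A *v k) = B *v (J *v (Ainv *v k))"
  unfolding wave_matrix_mult
  by (simp add: B_def matrix_vector_mult_diff_rdistrib matrix_vector_mult_diff_distrib)

lemma symbol_m_eq:
  "symbol_m A k = - 2 * ((J *v (Ainv *v k)) \<bullet> k / (k \<bullet> (Ainv *v k)))"
proof -
  have "k \<bullet> ((Ainv ** J) *v k) = - ((J *v (Ainv *v k)) \<bullet> k)"
    by (simp add: matrix_vector_mul_assoc [symmetric] inner_Ainv inner_J)
  then show ?thesis by (simp add: symbol_m_def)
qed

lemma quadratic_inv_pos: "k \<noteq> 0 \<Longrightarrow> 0 < k \<bullet> (Ainv *v k)"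
  using quadratic_pos[of "Ainv *v k"] by (metis inner_commute inv_mult_vec(2) matrix_vector_mult_0_right)

text \<open>
  The square of the length of \<open>integral_matrix *v y\<close> is a first integral of \<open>y' = B J y\<close>.  The first two
  rows together contribute \<open>B\<^sub>1\<^sub>1\<close> times the Hamiltonian \<open>J y \<cdot> B J y\<close>, with completed square.  The last row
  is the third column of the adjugate of \<open>B\<close>; it is conserved since \<open>B\<close> maps it to a multiple of the third unit
  vector, which is orthogonal to the range of \<open>J\<close>.
\<close>

definition integral_matrix :: "real^3^3" where
  "integral_matrix = vector [vector [- B $ 1 $ 2, B $ 1 $ 1, 0], vector [sqrt q, 0, 0],
     vector [B $ 1 $ 2 * B $ 2 $ 3 - B $ 1 $ 3 * B $ 2 $ 2, B $ 1 $ 2 * B $ 1 $ 3 - B $ 1 $ 1 * B $ 2 $ 3, q]]"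

lemma integral_matrix_mult: "integral_matrix *v y = vector [B $ 1 $ 1 * y $ 2 - B $ 1 $ 2 * y $ 1, sqrt q * y $ 1,
    (B $ 1 $ 2 * B $ 2 $ 3 - B $ 1 $ 3 * B $ 2 $ 2) * y $ 1
    + (B $ 1 $ 2 * B $ 1 $ 3 - B $ 1 $ 1 * B $ 2 $ 3) * y $ 2 + q * y $ 3]"
  by (simp add: integral_matrix_def vec_eq_iff forall_3 matrix_vector_mult_def sum_3)

lemma integral_matrix_bounded_below:
  assumes "0 < q" obtains c where "c > 0" "\<And>y. c * norm y \<le> norm (integral_matrix *v y)"
proof (rule linear_inj_bounded_below_pos[of "(*v) integral_matrix"])
  have b: "B $ 1 $ 1 \<noteq> 0" using assms by (auto simp: q_def not_less)
  have "y = 0" if "integral_matrix *v y = 0" for y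
    using that assms b by (auto simp: integral_matrix_mult vec_eq_iff forall_3)
  then show "inj ((*v) integral_matrix)"
    by (simp add: linear_injective_0[OF matrix_vector_mul_linear])
qed (use that in auto)

lemma integral_matrix_conserved:
  assumes q: "0 < q" and y: "(y has_vector_derivative B *v (J *v y t)) (at t within S)"
  shows "((\<lambda>t. (integral_matrix *v y t) \<bullet> (integral_matrix *v y t)) has_real_derivative 0) (at t within S)"
proof -
  have d: "((\<lambda>t. y t $ i) has_real_derivative B $ i $ 2 * y t $ 1 - B $ i $ 1 * y t $ 2) (at t within S)" for i
  proof -
    have "(B *v (J *v y t)) $ i = B $ i $ 2 * y t $ 1 - B $ i $ 1 * y t $ 2"
      unfolding J_mult by (simp add: matrix_vector_mult_def sum_3)
    then show ?thesis
      using bounded_linear.has_vector_derivative[OF bounded_linear_vec_nth y, of i]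
      by (simp add: has_real_derivative_iff_has_vector_derivative)
  qed
  have eq: "(integral_matrix *v y) \<bullet> (integral_matrix *v y) = (B $ 1 $ 1 * y $ 2 - B $ 1 $ 2 * y $ 1)\<^sup>2 + q * (y $ 1)\<^sup>2
    + ((B $ 1 $ 2 * B $ 2 $ 3 - B $ 1 $ 3 * B $ 2 $ 2) * y $ 1
    + (B $ 1 $ 2 * B $ 1 $ 3 - B $ 1 $ 1 * B $ 2 $ 3) * y $ 2 + q * y $ 3)\<^sup>2" for y
    using q by (simp add: integral_matrix_mult inner_vec_def sum_3 power2_eq_square)
  show ?thesis
    unfolding eq
    by (rule derivative_eq_intros d refl)+
       (simp add: q_def B_entries algebra_simps power2_eq_square)
qed

end

section \<open>Stability and instability\<close>

lemma norm_cvec [simp]: "norm (cvec k) = norm k"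
  by (simp add: norm_vec_def)

lemma norm_vector_scalar_mult: "norm (c *s (v::complex^3)) = norm c * norm v"
  by (simp add: norm_vec_def norm_mult L2_set_right_distrib)

lemma norm_wave_field: "norm (wave_field a k x) = 2 * pi * norm (a *\<^sub>R k)"
  by (simp add: wave_field_def plane_wave_eq norm_vector_scalar_mult norm_mult)

lemma L_infty_bounded_continuous:
  fixes g :: "'a::euclidean_space \<Rightarrow> complex^3"
  assumes "continuous_on UNIV g" "\<And>z. norm (g z) \<le> C"
  shows "g \<in> L_infty"
proof -
  have m: "g \<in> borel_measurable lebesgue"
    using borel_measurable_continuous_onI[OF assms(1)] by (simp add: measurable_completion)
  have "L_infty_norm g \<le> ereal C"
    unfolding L_infty_norm_def using m assms(2) by (intro esssup_I) auto
  also have "\<dots> < \<infinity>" by simp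
  finally show ?thesis using m by (simp add: L_infty_def)
qed

context steady_state
begin

text \<open>
  The conserved quantity \<open>a (k \<cdot> A\<^sup>-\<^sup>1 k)\<close>, which ties the amplitude to the length of the wave vector.
\<close>

definition amplitude_integral :: "real \<Rightarrow> real^3 \<Rightarrow> real" where
  "amplitude_integral a k = a * (k \<bullet> (Ainv *v k))"

context
  fixes a :: "real \<Rightarrow> real" and k :: "real \<Rightarrow> real^3" and t :: real and S :: "real set"
  assumes k: "(k has_vector_derivative wave_matrix A *v k t) (at t within S)"
begin

lemma inv_wave_vector_ode:
  "((\<lambda>s. Ainv *v k s) has_vector_derivative B *v (J *v (Ainv *v k t))) (at t within S)"
  using bounded_linear.has_vector_derivative[OF matrix_vector_mul_bounded_linear k, of Ainv]
  by (simp add: inv_wave_matrix_mult)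

lemma amplitude_integral_conserved:
  assumes a: "(a has_real_derivative symbol_m A (k t) * a t) (at t within S)" and nz: "k t \<noteq> 0"
  shows "((\<lambda>s. amplitude_integral (a s) (k s)) has_real_derivative 0) (at t within S)"
proof -
  define y where "y = Ainv *v k t"
  have "((\<lambda>s. k s \<bullet> (Ainv *v k s)) has_vector_derivative
      k t \<bullet> (Ainv *v (wave_matrix A *v k t)) + (wave_matrix A *v k t) \<bullet> (Ainv *v k t)) (at t within S)"
    by (rule bounded_bilinear.has_vector_derivative[OF bounded_bilinear_inner k
          bounded_linear.has_vector_derivative[OF matrix_vector_mul_bounded_linear k]])
  moreover have "k t \<bullet> (Ainv *v (wave_matrix A *v k t)) = (wave_matrix A *v k t) \<bullet> y"
    by (simp add: inner_Ainv y_def inner_commute)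
  moreover have "(wave_matrix A *v k t) \<bullet> y = (J *v y) \<bullet> k t"
  proof -
    have "(wave_matrix A *v k t) \<bullet> y = y \<bullet> (A *v (J *v y)) - y \<bullet> (J *v y)"
      by (simp add: wave_matrix_mult y_def [symmetric] matrix_vector_mult_diff_rdistrib inner_commute inner_diff_right)
    also have "y \<bullet> (J *v y) = 0" using inner_J[of y y] by (simp add: inner_commute)
    also have "y \<bullet> (A *v (J *v y)) = (J *v y) \<bullet> k t" by (simp add: inner_A y_def inner_commute)
    finally show ?thesis by simp
  qed
  ultimately have "((\<lambda>s. k s \<bullet> (Ainv *v k s)) has_real_derivative 2 * ((J *v y) \<bullet> k t)) (at t within S)"
    by (simp add: has_real_derivative_iff_has_vector_derivative y_def)
  from DERIV_mult[OF a this] show ?thesis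
    unfolding amplitude_integral_def
    by (rule DERIV_cong) (use quadratic_inv_pos[OF nz] in \<open>simp add: symbol_m_eq y_def field_simps\<close>)
qed

end

end

text \<open>
  A strong solution of plane-wave form in the elliptic case.
\<close>

locale elliptic_wave = steady_state A + weak_plane_wave A a k for A a k +
  assumes elliptic: "0 < q"
begin

text \<open>
  The level sets of the first integral; for \<open>c > 0\<close> they are ellipsoids around the origin.
\<close>

definition level :: "real \<Rightarrow> (real^3) set" where
  "level c = {y. (integral_matrix *v y) \<bullet> (integral_matrix *v y) = c}"

lemma compact_level: "compact (level c)"
proof -
  have "closed (level c)"
    unfolding level_def by (intro closed_Collect_eq continuous_intros)
  moreover obtain d where d: "d > 0" "\<And>y. d * norm y \<le> norm (integral_matrix *v y)"
    using integral_matrix_bounded_below[OF elliptic] by blast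
  have "norm y \<le> sqrt c / d" if "y \<in> level c" for y
    using d(1) d(2)[of y] that by (simp add: level_def norm_eq_sqrt_inner field_simps)
  then have "bounded (level c)" by (auto simp: bounded_iff)
  ultimately show ?thesis by (simp add: compact_eq_bounded_closed)
qed

lemma zero_notin_level: "y \<in> level c \<Longrightarrow> 0 < c \<Longrightarrow> y \<noteq> 0"
  by (auto simp: level_def)

lemma level_pos:
  assumes "y \<noteq> 0" shows "0 < (integral_matrix *v y) \<bullet> (integral_matrix *v y)"
proof -
  obtain d where "d > 0" "\<And>y. d * norm y \<le> norm (integral_matrix *v y)"
    using integral_matrix_bounded_below[OF elliptic] by blast
  then have "integral_matrix *v y \<noteq> 0" using assms by (metis mult_pos_pos norm_zero not_le zero_less_norm_iff)
  then show ?thesis by simp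
qed

text \<open>
  The length of \<open>a k\<close> in terms of \<open>y = A\<^sup>-\<^sup>1 k\<close> and of the value \<open>c\<close> of the conserved quantity
  \<open>a (k \<cdot> A\<^sup>-\<^sup>1 k)\<close>.
\<close>

definition wave_size :: "real \<Rightarrow> real^3 \<Rightarrow> real" where
  "wave_size c y = \<bar>c\<bar> * norm (A *v y) / (y \<bullet> (A *v y))"

lemma continuous_wave_size: "continuous_on (level c - {0}) (wave_size r)"
proof -
  have "y \<bullet> (A *v y) \<noteq> 0" if "y \<in> level c - {0}" for y using quadratic_pos[of y] that by auto
  then show ?thesis unfolding wave_size_def by (intro continuous_intros) auto
qed

lemma norm_eq_wave_size:
  assumes "k t \<noteq> 0"
  shows "norm (a t *\<^sub>R k t) = wave_size (amplitude_integral (a t) (k t)) (Ainv *v k t)"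
  using quadratic_inv_pos[OF assms] by (simp add: wave_size_def amplitude_integral_def abs_mult inner_commute)

lemma first_integrals_constant:
  assumes W: "W \<subseteq> support" "convex W" and st: "s \<in> W" "t \<in> W"
  shows "(integral_matrix *v (Ainv *v k s)) \<bullet> (integral_matrix *v (Ainv *v k s)) = (integral_matrix *v (Ainv *v k t)) \<bullet> (integral_matrix *v (Ainv *v k t))"
    and "amplitude_integral (a s) (k s) = amplitude_integral (a t) (k t)"
proof -
  have k: "(k has_vector_derivative wave_matrix A *v k t) (at t within W)" if "t \<in> W" for t
    using wave_vector_ode W that by (blast intro: has_vector_derivative_at_within)
  have a: "(a has_real_derivative symbol_m A (k t) * a t) (at t within W)" if "t \<in> W" for t
    using amplitude_ode W that by (blast intro: has_field_derivative_at_within)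
  show "(integral_matrix *v (Ainv *v k s)) \<bullet> (integral_matrix *v (Ainv *v k s)) = (integral_matrix *v (Ainv *v k t)) \<bullet> (integral_matrix *v (Ainv *v k t))"
    using has_field_derivative_zero_constant[OF W(2) integral_matrix_conserved[OF elliptic inv_wave_vector_ode[OF k]]] st
    by metis
  have "k t \<noteq> 0" if "t \<in> W" for t using that W(1) by (auto simp: support_def)
  then show "amplitude_integral (a s) (k s) = amplitude_integral (a t) (k t)"
    using has_field_derivative_zero_constant[OF W(2) amplitude_integral_conserved[OF k a]] st by metis
qed

text \<open>
  The length of the vector of the moments \<open>moment0 j\<close>.  It is continuous at all times,
  whereas \<open>a\<close> and \<open>k\<close> may jump where the wave vanishes.
\<close>

definition moment_size :: "real \<Rightarrow> real" where
  "moment_size t = norm (a t *\<^sub>R k t) * gaussian_hat (k t)"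

lemma continuous_moment_size: "continuous_on UNIV moment_size"
proof -
  have "moment_size t = norm (\<chi> j. moment0 j t)" for t
  proof -
    have "(\<chi> j. moment0 j t) = gaussian_hat (k t) *\<^sub>R a t *\<^sub>R k t"
      by (simp add: vec_eq_iff moment0_def)
    then show ?thesis using gaussian_hat_pos[of "k t"] by (simp add: moment_size_def abs_mult)
  qed
  then have "moment_size = (\<lambda>t. norm (\<chi> j. moment0 j t))" by blast
  then show ?thesis by (simp add: continuous_intros continuous_moment0)
qed

lemma moment_size_pos_iff: "0 < moment_size t \<longleftrightarrow> t \<in> support"
  using gaussian_hat_pos[of "k t"] by (auto simp: moment_size_def support_def zero_less_mult_iff)

text \<open>
  A solution that vanishes at some time vanishes identically.  On the component \<open>W\<close> of a time \<open>t0\<close> in the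
  support, \<open>moment_size\<close> is bounded below by the minimum of a positive continuous function on an ellipsoid; by continuity
  the bound persists on the closure of \<open>W\<close>, which hence stays in the support.
\<close>

lemma support_empty_or_UNIV:
  assumes t0: "t0 \<in> support" shows "support = UNIV"
proof -
  define W where "W = connected_component_set support t0"
  define c where "c = (integral_matrix *v (Ainv *v k t0)) \<bullet> (integral_matrix *v (Ainv *v k t0))"
  define r where "r = amplitude_integral (a t0) (k t0)"
  define f where "f y = wave_size r y * gaussian_hat (A *v y)" for y
  have WS: "W \<subseteq> support" unfolding W_def by (rule connected_component_subset)
  have t0W: "t0 \<in> W" using t0 by (simp add: W_def connected_component_refl)
  have conn: "connected W" unfolding W_def by (rule connected_connected_component)
  have k0: "k t0 \<noteq> 0" "a t0 \<noteq> 0" using t0 by (auto simp: support_def)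
  have c: "0 < c" unfolding c_def using quadratic_inv_pos[OF k0(1)] by (intro level_pos) auto
  have r: "r \<noteq> 0" using quadratic_inv_pos[OF k0(1)] k0(2) by (simp add: r_def amplitude_integral_def)
  have on_level: "Ainv *v k t \<in> level c" and size: "moment_size t = f (Ainv *v k t)" if "t \<in> W" for t
  proof -
    have "convex W" using conn by (simp add: is_interval_convex_1 [symmetric] is_interval_connected_1)
    note const = first_integrals_constant[OF WS this that t0W]
    show "Ainv *v k t \<in> level c" using const(1) by (simp add: level_def c_def)
    have "k t \<noteq> 0" using that WS by (auto simp: support_def)
    then show "moment_size t = f (Ainv *v k t)"
      using const(2) by (simp add: moment_size_def f_def norm_eq_wave_size r_def del: norm_scaleR)
  qed
  have "level c - {0} = level c" using zero_notin_level c by blast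
  then have "continuous_on (level c) f"
    unfolding f_def using continuous_wave_size[of c r] by (auto intro!: continuous_intros)
  then obtain y0 where y0: "y0 \<in> level c" "\<And>y. y \<in> level c \<Longrightarrow> f y0 \<le> f y"
    using continuous_attains_inf[OF compact_level, of c f] on_level[OF t0W] by blast
  have "y0 \<noteq> 0" using zero_notin_level y0(1) c by blast
  then have "0 < y0 \<bullet> (A *v y0)" by (rule quadratic_pos)
  moreover from this have "A *v y0 \<noteq> 0" by auto
  ultimately have pos: "0 < f y0"
    using r gaussian_hat_pos[of "A *v y0"] by (simp add: f_def wave_size_def)
  have "W \<subseteq> {t. f y0 \<le> moment_size t}" using size on_level y0(2) by auto
  moreover have "closed {t. f y0 \<le> moment_size t}"
    by (intro closed_Collect_le continuous_intros continuous_moment_size)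
  ultimately have "closure W \<subseteq> {t. f y0 \<le> moment_size t}" by (rule closure_minimal)
  then have "closure W \<subseteq> support" using pos by (auto simp flip: moment_size_pos_iff)
  then have "closure W \<subseteq> W"
    unfolding W_def
    by (intro connected_component_maximal)
       (use subsetD[OF closure_subset t0W] conn in \<open>auto simp: W_def connected_imp_connected_closure\<close>)
  then have "closed W" using closure_subset_eq by blast
  moreover have "open W" unfolding W_def by (rule open_connected_component[OF open_support])
  ultimately have "W = UNIV" using t0W connected_UNIV by (auto simp: connected_clopen)
  then show ?thesis using WS by auto
qed

lemma wave_in_L_infty: "(\<lambda>(x, t). wave_field (a t) (k t) x) \<in> L_infty"
proof (cases "support = {}")
  case True
  then have "wave_field (a t) (k t) x = 0" for x t
    by (auto simp: support_def vec_eq_iff wave_field_nth)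
  then show ?thesis by (intro L_infty_bounded_continuous[where C = 0]) (auto simp: case_prod_unfold)
next
  case False
  then have U: "support = UNIV" using support_empty_or_UNIV by blast
  have kc: "continuous_on UNIV k"
    using wave_vector_ode U by (intro continuous_at_imp_continuous_on) (auto intro: has_vector_derivative_continuous)
  have ac: "continuous_on UNIV a"
    using amplitude_ode U by (intro continuous_at_imp_continuous_on) (auto intro: DERIV_isCont)
  define c where "c = (integral_matrix *v (Ainv *v k 0)) \<bullet> (integral_matrix *v (Ainv *v k 0))"
  define r where "r = amplitude_integral (a 0) (k 0)"
  have nz: "k t \<noteq> 0" for t using U by (auto simp: support_def)
  have c: "0 < c" unfolding c_def using quadratic_inv_pos[OF nz, of 0] by (intro level_pos) auto
  have "level c - {0} = level c" using zero_notin_level c by blast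
  then have "continuous_on (level c) (wave_size r)" using continuous_wave_size[of c r] by simp
  then have "bounded (wave_size r ` level c)"
    by (intro compact_imp_bounded compact_continuous_image compact_level)
  then obtain M where M: "\<And>y. y \<in> level c \<Longrightarrow> \<bar>wave_size r y\<bar> \<le> M" by (auto simp: bounded_iff)
  have bound: "norm (a t *\<^sub>R k t) \<le> M" for t
  proof -
    note const = first_integrals_constant[OF subset_refl, unfolded U, OF convex_UNIV UNIV_I UNIV_I, of t 0]
    have "Ainv *v k t \<in> level c" using const(1) by (simp add: level_def c_def)
    then show ?thesis using M const(2) by (simp only: norm_eq_wave_size[OF nz] r_def) (metis abs_le_D1)
  qed
  show ?thesis
  proof (rule L_infty_bounded_continuous[where C = "2 * pi * M"])
    show "norm (case z of (x, t) \<Rightarrow> wave_field (a t) (k t) x) \<le> 2 * pi * M" for z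
      using bound by (simp add: case_prod_unfold norm_wave_field mult_left_mono del: norm_scaleR)
    show "continuous_on UNIV (\<lambda>(x, t). wave_field (a t) (k t) x)"
      unfolding case_prod_unfold
      by (intro continuous_on_componentwise_cart)
         (simp only: wave_field_nth, intro continuous_intros continuous_on_compose2[OF kc] continuous_on_compose2[OF ac], auto)
  qed
qed

end

context steady_state
begin

lemma elliptic_stable:
  assumes "mu A < 0" shows "plane_wave_stable (potential A)"
  unfolding plane_wave_stable_def potential_matrix_potential[OF symmetric]
proof (intro allI impI)
  fix \<phi> assume "plane_wave_solution A \<phi>"
  then obtain a k where \<phi>: "\<phi> = (\<lambda>x t. wave_field (a t) (k t) x)" and s: "strong_solution A \<phi>"
    unfolding plane_wave_solution_def gradient_wave by blast
  interpret elliptic_wave A a k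
    by unfold_locales (use s \<phi> q_pos[OF assms] in auto)
  show "(\<lambda>(x, t). \<phi> x t) \<in> L_infty" using wave_in_L_infty by (simp add: \<phi>)
qed

text \<open>
  The characteristic polynomial of \<open>B J\<close> is \<open>- x\<^sup>3 - q x\<close>, so that in the hyperbolic case
  \<open>- sqrt (- q)\<close> is an eigenvalue.
\<close>

lemma exists_decaying_direction:
  assumes "q < 0" shows "\<exists>y. y \<noteq> 0 \<and> B *v (J *v y) = - sqrt (- q) *\<^sub>R y"
proof -
  define l where "l = sqrt (- q)"
  have l2: "l * l = - q" using assms by (simp add: l_def)
  define M where "M = B ** J + mat l"
  have "det M = l * (l * l + q)"
    by (simp add: M_def det_3 matrix_matrix_mult_def sum_3 J_def mat_def q_def B_entries algebra_simps power2_eq_square)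
  then have "det M = 0" using l2 by simp
  then have "\<exists>y. y \<noteq> 0 \<and> M *v y = 0"
    by (simp add: matrix_nonfull_linear_equations_eq det_eq_0_rank)
  moreover have "M *v y = B *v (J *v y) + l *\<^sub>R y" for y
    by (simp add: M_def matrix_vector_mult_add_rdistrib matrix_vector_mul_assoc)
       (simp add: vec_eq_iff matrix_vector_mult_def mat_def if_distrib [of "\<lambda>x. x * _"] cong: if_cong)
  ultimately show ?thesis by (auto simp: l_def add_eq_0_iff2)
qed

text \<open>
  The wave vector decays like \<open>exp (- l t)\<close> with \<open>l = sqrt (- q)\<close>.  Along it \<open>m\<close> has the constant value
  \<open>2 l\<close>, so that the amplitude grows like \<open>exp (2 l t)\<close> and the field like \<open>exp (l t)\<close>.
\<close>

lemma unbounded_wave: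
  assumes "0 < mu A"
  obtains a k where "plane_wave_solution A (\<lambda>x t. wave_field (a t) (k t) x)"
    "\<And>C. \<exists>T. \<forall>t\<ge>T. \<forall>x. C < norm (wave_field (a t) (k t) x)"
proof -
  have q: "q < 0" by (rule q_neg[OF assms])
  define l where "l = sqrt (- q)"
  have l: "0 < l" using q by (simp add: l_def)
  obtain y where y: "y \<noteq> 0" "B *v (J *v y) = - l *\<^sub>R y"
    using exists_decaying_direction[OF q] by (auto simp: l_def)
  define k0 where "k0 = A *v y"
  define k where "k t = exp (- l * t) *\<^sub>R k0" for t
  define a where "a t = exp (2 * l * t)" for t :: real
  have k0: "k0 \<noteq> 0" using quadratic_pos[OF y(1)] by (auto simp: k0_def)
  have "(A - mat 1) *v (J *v y) = A *v (B *v (J *v y))"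
    by (simp add: B_def matrix_vector_mult_diff_rdistrib matrix_vector_mult_diff_distrib)
  then have eig: "(A - mat 1) *v (J *v y) = - l *\<^sub>R k0"
    by (simp only: y(2) k0_def matrix_vector_mult_scaleR)
  have ode_k: "(k has_vector_derivative wave_matrix A *v k t) (at t)" for t
  proof -
    have "wave_matrix A *v k t = (exp (- l * t) * (- l)) *\<^sub>R k0"
      using eig by (simp add: wave_matrix_mult k_def matrix_vector_mult_scaleR k0_def)
    moreover have "((\<lambda>t. exp (- l * t)) has_real_derivative exp (- l * t) * (- l)) (at t)"
      by (auto intro!: derivative_eq_intros)
    ultimately show ?thesis
      using has_vector_derivative_scaleR[OF _ has_vector_derivative_const[of k0]]
      unfolding k_def by fastforce
  qed
  have m: "symbol_m A (k t) = 2 * l" for t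
  proof -
    have "(J *v y) \<bullet> k0 = y \<bullet> ((A - mat 1) *v (J *v y)) + y \<bullet> (J *v y)"
      by (simp add: k0_def inner_A inner_diff_right matrix_vector_mult_diff_rdistrib inner_commute)
    also have "y \<bullet> (J *v y) = 0" using inner_J[of y y] by (simp add: inner_commute)
    finally have "(J *v y) \<bullet> k0 = - l * (k0 \<bullet> y)" by (simp add: eig inner_commute)
    moreover have "0 < k0 \<bullet> y" using quadratic_pos[OF y(1)] by (simp add: k0_def inner_commute)
    ultimately show ?thesis
      by (simp add: symbol_m_eq k_def matrix_vector_mult_scaleR k0_def)
  qed
  have ode_a: "(a has_real_derivative symbol_m A (k t) * a t) (at t)" for t
    unfolding m a_def by (auto intro!: derivative_eq_intros)
  have n: "norm (wave_field (a t) (k t) x) = exp (l * t) * (2 * pi * norm k0)" for t x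
    by (simp add: norm_wave_field a_def k_def exp_minus divide_inverse [symmetric] exp_diff [symmetric] mult_exp_exp)
  show thesis
  proof
    show "plane_wave_solution A (\<lambda>x t. wave_field (a t) (k t) x)"
      by (rule plane_wave_solution_of_ode[OF ode_k ode_a]) (simp add: m)
    fix C :: real
    have "filterlim (\<lambda>t. exp (l * t) * (2 * pi * norm k0)) at_top at_top"
      using l k0 by (intro filterlim_at_top_mult_tendsto_pos[OF tendsto_const] filterlim_compose[OF exp_at_top]
        filterlim_tendsto_pos_mult_at_top[OF tendsto_const] filterlim_ident) auto
    then have "\<forall>\<^sub>F t in at_top. C < exp (l * t) * (2 * pi * norm k0)"
      by (simp add: filterlim_at_top_dense)
    then show "\<exists>T. \<forall>t\<ge>T. \<forall>x. C < norm (wave_field (a t) (k t) x)"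
      unfolding n by (auto simp: eventually_at_top_linorder)
  qed
qed

lemma hyperbolic_unstable:
  assumes "0 < mu A"
  shows "plane_wave_unstable (potential A)" and "has_unbounded_plane_wave (potential A)"
proof -
  obtain a k where sol: "plane_wave_solution A (\<lambda>x t. wave_field (a t) (k t) x)"
    and large: "\<And>C. \<exists>T. \<forall>t\<ge>T. \<forall>x. C < norm (wave_field (a t) (k t) x)"
    using unbounded_wave[OF assms] by blast
  have "(\<lambda>(x, t). wave_field (a t) (k t) x) \<notin> L_infty"
  proof
    let ?g = "\<lambda>(x, t). wave_field (a t) (k t) x"
    assume "?g \<in> L_infty"
    then obtain C where C: "L_infty_norm ?g \<le> ereal C"
      by (auto simp: L_infty_def less_PInf_Ex_of_nat intro: less_imp_le)
    have "AE z in lebesgue. ereal (norm (?g z)) \<le> L_infty_norm ?g"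
      unfolding L_infty_norm_def by (rule esssup_AE)
    then have ae: "AE z in lebesgue. norm (?g z) \<le> C"
      using C by (auto elim!: eventually_mono dest: order_trans)
    obtain T where T: "\<And>t x. t \<ge> T \<Longrightarrow> C < norm (wave_field (a t) (k t) x)"
      using large by blast
    \<comment> \<open>the wave exceeds the bound on an open half-space of space-time, which is not a null set\<close>
    have "AE z in lebesgue. z \<notin> (UNIV :: (real^3) set) \<times> {T<..}"
      using ae
    proof (rule eventually_mono)
      fix z assume "norm (?g z) \<le> C"
      then show "z \<notin> UNIV \<times> {T<..}"
        using T[of "snd z" "fst z"] by (auto simp: case_prod_unfold)
    qed
    then have "negligible ((UNIV :: (real^3) set) \<times> {T<..})"
      by (simp add: negligible_iff_null_sets AE_iff_null_sets open_Times)
    moreover have "open ((UNIV :: (real^3) set) \<times> {T<..})" by (intro open_Times) auto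
    ultimately show False using open_not_negligible[of "(UNIV :: (real^3) set) \<times> {T<..}"]
      by (metis UNIV_I UNIV_not_empty Times_empty empty_iff gt_ex greaterThan_iff)
  qed
  then show "plane_wave_unstable (potential A)"
    unfolding plane_wave_unstable_def plane_wave_stable_def potential_matrix_potential[OF symmetric]
    using sol by blast
  have "\<exists>t. L_infty_norm (\<lambda>x. wave_field (a t) (k t) x) > ereal C" for C
  proof -
    obtain t where t: "C < norm (wave_field (a t) (k t) x)" for x using large by blast
    have "L_infty_norm (\<lambda>x. wave_field (a t) (k t) x) = ereal (2 * pi * norm (a t *\<^sub>R k t))"
      unfolding L_infty_norm_def norm_wave_field by (rule esssup_const) simp
    then show ?thesis using t[of 0] by (intro exI[of _ t]) (simp add: norm_wave_field)
  qed
  then show "has_unbounded_plane_wave (potential A)"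
    unfolding has_unbounded_plane_wave_def potential_matrix_potential[OF symmetric] using sol by blast
qed

end

theorem theorem1p4:
  fixes A :: "real^3^3"
  assumes "transpose A = A"
    and "positive_definite A"
  shows "(mu A < 0 \<longrightarrow> plane_wave_stable (potential A)) \<and>
         (mu A > 0 \<longrightarrow> plane_wave_unstable (potential A) \<and> has_unbounded_plane_wave (potential A))"
proof -
  interpret steady_state A by unfold_locales (rule assms)+
  show ?thesis using elliptic_stable hyperbolic_unstable by blast
qed

end
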